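(* Let $\phi\in\mathrm{Rat}_d$, $d\ge 3$ odd, with $\mathrm{Aut}(\phi)\cong\mathbb{Z}_n$ for some $n\ge 2$. Then $\phi$ is pseudo-real if and only if it can be conjugated (by a Möbius transformation) to a rational map $\widetilde\phi(z)=z\,\psi(z^n)$, with $\psi$ a rational map, such that (1) $\psi(z)\neq\overline{\psi}(e^{i\theta}z)$ (as rational maps), for every $\theta\in\mathbb{R}$, and (2) there is some $\alpha\in\mathbb{C}\setminus\{0\}$ with $|\alpha|=1$ and $\alpha^n\neq 1$ such that $\psi(z)\,\overline{\psi}(\alpha^n/z)=1$ (identically in $z$).
   Context: $\mathrm{Rat}_d$ is the space of complex rational maps of degree $d$. $\mathrm{Aut}(\phi)=\{T\in\mathrm{PSL}_2(\mathbb{C}):T\circ\phi\circ T^{-1}=\phi\}$. For a rational map $\psi$, $\overline\psi$ denotes the rational map obtained by conjugating the coefficients of $\psi$, i.e. $\overline\psi=J\circ\psi\circ J$ with $J(z)=\overline z$. An antiholomorphic automorphism of $\phi$ is a map $Q=T\circ J$, $T\in\mathrm{PSL}_2(\mathbb{C})$, with $Q\circ\phi\circ Q^{-1}=\phi$. A reflection is an antiholomorphic involution of $\widehat{\mathbb{C}}$ with fixed points. A rational map is pseudo-real if it admits antiholomorphic automorphisms but none of them is a reflection. *)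

theory Defs
  imports
    "HOL-Algebra.Elementary_Groups"
    "HOL-Computational_Algebra.Computational_Algebra"
    "HOL-Computational_Algebra.Field_as_Ring"
begin

section \<open>The Riemann sphere and its conformal and anticonformal maps\<close>

datatype csphere = Pt complex | Inf

text \<open>For \<open>c \<noteq> 0\<close> the map \<open>z \<mapsto> (a z + b) / (c z + d)\<close> sends \<open>- d / c\<close> to \<open>Inf\<close> and
  \<open>Inf\<close> to \<open>a / c\<close>; it is only used with \<open>a d - b c \<noteq> 0\<close>.\<close>

fun moebius :: "complex \<Rightarrow> complex \<Rightarrow> complex \<Rightarrow> complex \<Rightarrow> csphere \<Rightarrow> csphere" where
  "moebius a b c d (Pt z) = (if c * z + d = 0 then Inf else Pt ((a * z + b) / (c * z + d)))"
| "moebius a b c d Inf = (if c = 0 then Inf else Pt (a / c))"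

definition PSL2C :: "(csphere \<Rightarrow> csphere) set" where
  "PSL2C = {moebius a b c d | a b c d. a * d - b * c = 1}"

fun sphere_cnj :: "csphere \<Rightarrow> csphere" where
  "sphere_cnj (Pt z) = Pt (cnj z)"
| "sphere_cnj Inf = Inf"

definition antimoebius :: "(csphere \<Rightarrow> csphere) set" where
  "antimoebius = {T \<circ> sphere_cnj | T. T \<in> PSL2C}"

text \<open>The antiholomorphic bijections of the sphere are exactly the members of
  \<open>antimoebius\<close>, so the involutions below are the antiholomorphic ones.\<close>

definition is_reflection :: "(csphere \<Rightarrow> csphere) \<Rightarrow> bool" where
  "is_reflection Q \<longleftrightarrow> Q \<in> antimoebius \<and> Q \<circ> Q = id \<and> (\<exists>x. Q x = x)"


section \<open>Rational functions and rational maps\<close>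

text \<open>Algebraic identities between rational functions, such as products, are taken in the
  field \<open>\<complex>(z)\<close>; each of its elements acts on the sphere through its representation in
  lowest terms.\<close>

type_synonym ratfun = "complex poly fract"

definition rat_deg :: "ratfun \<Rightarrow> nat" where
  "rat_deg f = (case quot_of_fract f of (p, q) \<Rightarrow> max (degree p) (degree q))"

text \<open>In lowest terms \<open>p\<close> and \<open>q\<close> have no common root. At infinity, if
  \<open>degree p \<le> degree q\<close>, the limit of \<open>p / q\<close> is the quotient of the coefficients of
  index \<open>degree q\<close>.\<close>

fun rat_map :: "ratfun \<Rightarrow> csphere \<Rightarrow> csphere" where
  "rat_map f (Pt z) =
     (case quot_of_fract f of (p, q) \<Rightarrow>
        if poly q z = 0 then Inf else Pt (poly p z / poly q z))"
| "rat_map f Inf =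
     (case quot_of_fract f of (p, q) \<Rightarrow>
        if degree p > degree q then Inf
        else Pt (Polynomial.coeff p (degree q) / Polynomial.coeff q (degree q)))"

text \<open>The constant map with value \<open>Inf\<close> is not induced by an element of \<open>\<complex>(z)\<close>, so it is
  missing from \<open>Rat 0\<close>; for \<open>d \<ge> 1\<close> the set is the full space of rational maps of
  degree \<open>d\<close>.\<close>

definition Rat :: "nat \<Rightarrow> (csphere \<Rightarrow> csphere) set" where
  "Rat d = {rat_map f | f. rat_deg f = d}"

abbreviation rat_const :: "complex \<Rightarrow> ratfun" where
  "rat_const c \<equiv> to_fract [:c:]"

abbreviation rat_var :: ratfun where
  "rat_var \<equiv> to_fract [:0, 1:]"

text \<open>The composition \<open>z \<mapsto> f (g z)\<close>, by substituting \<open>g\<close> for the variable in numerator and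
  denominator; meaningful for non-constant \<open>g\<close>, where the denominator cannot vanish.\<close>

definition rat_comp :: "ratfun \<Rightarrow> ratfun \<Rightarrow> ratfun" where
  "rat_comp f g =
     (case quot_of_fract f of (p, q) \<Rightarrow>
        poly (map_poly rat_const p) g / poly (map_poly rat_const q) g)"

definition rat_cnj :: "ratfun \<Rightarrow> ratfun" where
  "rat_cnj f = (case quot_of_fract f of (p, q) \<Rightarrow> Fract (map_poly cnj p) (map_poly cnj q))"

lemma map_poly_cnj_mult: "map_poly cnj (p * q) = map_poly cnj p * map_poly cnj q"
  by (rule poly_eqI) (simp add: coeff_map_poly coeff_mult)

lemma map_poly_cnj_cnj [simp]: "map_poly cnj (map_poly cnj p) = p"
  by (rule poly_eqI) (simp add: coeff_map_poly)

lemma poly_map_poly_cnj: "poly (map_poly cnj p) z = cnj (poly p (cnj z))"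
  by (induction p) (auto simp: map_poly_pCons)

lemma degree_map_poly_cnj [simp]: "degree (map_poly cnj p) = degree p"
  by (rule degree_map_poly) simp

lemma quot_of_fract_rat_cnj:
  assumes "quot_of_fract f = (p, q)"
  shows "quot_of_fract (rat_cnj f) = (map_poly cnj p, map_poly cnj q)"
proof -
  have c: "coprime p q" using coprime_quot_of_fract[of f] assms by simp
  have u: "unit_factor q = 1" using unit_factor_snd_quot_of_fract[of f] assms by simp
  have "coprime (map_poly cnj p) (map_poly cnj q)"
  proof (rule coprimeI)
    fix r assume "r dvd map_poly cnj p" "r dvd map_poly cnj q"
    then obtain a b where "map_poly cnj p = r * a" "map_poly cnj q = r * b"
      by (auto elim!: dvdE)
    then have "p = map_poly cnj r * map_poly cnj a" "q = map_poly cnj r * map_poly cnj b"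
      by (metis map_poly_cnj_cnj map_poly_cnj_mult)+
    then have "is_unit (map_poly cnj r)"
      using c by (meson coprime_common_divisor dvdI)
    moreover from this have "r \<noteq> 0" by auto
    moreover from this have "map_poly cnj r \<noteq> 0" by (metis map_poly_0 map_poly_cnj_cnj)
    ultimately show "is_unit r" by (simp add: is_unit_iff_degree)
  qed
  moreover have "unit_factor (map_poly cnj q) = 1"
    using u by (simp add: unit_factor_poly_def coeff_map_poly monom_0 one_pCons)
  ultimately have "(map_poly cnj p, map_poly cnj q) \<in> normalized_fracts"
    by (simp add: normalized_fracts_def)
  then show ?thesis
    using quot_of_fract_quot_to_fract'[of "(map_poly cnj p, map_poly cnj q)"] assms
    by (simp add: rat_cnj_def quot_to_fract_def)
qed

lemma rat_map_rat_cnj: "rat_map (rat_cnj f) = sphere_cnj \<circ> rat_map f \<circ> sphere_cnj"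
proof
  fix z
  obtain p q where "quot_of_fract f = (p, q)" by fastforce
  then show "rat_map (rat_cnj f) z = (sphere_cnj \<circ> rat_map f \<circ> sphere_cnj) z"
    by (cases z) (simp_all add: quot_of_fract_rat_cnj poly_map_poly_cnj coeff_map_poly)
qed


section \<open>Automorphisms\<close>

definition Aut :: "(csphere \<Rightarrow> csphere) \<Rightarrow> (csphere \<Rightarrow> csphere) set" where
  "Aut \<phi> = {T \<in> PSL2C. T \<circ> \<phi> \<circ> inv_into UNIV T = \<phi>}"

definition Aut_group :: "(csphere \<Rightarrow> csphere) \<Rightarrow> (csphere \<Rightarrow> csphere) monoid" where
  "Aut_group \<phi> = \<lparr>carrier = Aut \<phi>, monoid.mult = (\<circ>), one = id\<rparr>"

definition antiAut :: "(csphere \<Rightarrow> csphere) \<Rightarrow> (csphere \<Rightarrow> csphere) set" where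
  "antiAut \<phi> = {Q \<in> antimoebius. Q \<circ> \<phi> \<circ> inv_into UNIV Q = \<phi>}"

definition pseudo_real :: "(csphere \<Rightarrow> csphere) \<Rightarrow> bool" where
  "pseudo_real \<phi> \<longleftrightarrow> antiAut \<phi> \<noteq> {} \<and> (\<forall>Q \<in> antiAut \<phi>. \<not> is_reflection Q)"

definition moebius_conjugate :: "(csphere \<Rightarrow> csphere) \<Rightarrow> (csphere \<Rightarrow> csphere) \<Rightarrow> bool" where
  "moebius_conjugate \<phi> \<phi>' \<longleftrightarrow> (\<exists>T \<in> PSL2C. \<phi>' = T \<circ> \<phi> \<circ> inv_into UNIV T)"

end

theory Submission
  imports Defs
begin

text \<open>
  Both sides of the equivalence are invariant under Moebius conjugation, so \<open>\<phi>\<close> may be put into a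
  normal form. A generator of the cyclic automorphism group has finite order, hence two fixed
  points, and conjugation moves these to \<open>0\<close> and \<open>\<infinity>\<close>: the group becomes the group of rotations
  \<open>z \<mapsto> w z\<close> with \<open>w ^ n = 1\<close> (\<open>finite_order_diagonalizable\<close>). Commuting with the rotations means
  that \<open>\<phi> z / z\<close> is invariant under them, so it is a function of \<open>z ^ n\<close>, and \<open>\<phi>\<close> has the form
  \<open>z \<psi>(z ^ n)\<close> (\<open>equivariant_form\<close>).

  An antiholomorphic automorphism \<open>Q\<close> normalizes the rotation group and so permutes \<open>{0, \<infinity>}\<close>. If it
  fixes both points, then \<open>Q z = c * cnj z\<close>, and \<open>Q \<circ> Q\<close> is multiplication by \<open>\<bar>c\<bar>\<^sup>2\<close>; this is a
  rotation, so \<open>\<bar>c\<bar> = 1\<close> and \<open>Q\<close> is a reflection in a line. A pseudo-real map therefore only has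
  antiholomorphic automorphisms \<open>c / cnj z\<close>, and a dilation achieves \<open>\<bar>c\<bar> = 1\<close>
  (\<open>pseudo_real_normal_form\<close>). That \<open>\<alpha> / cnj z\<close> is an automorphism is, written out, the identity
  \<open>\<psi>(z) * \<psi>'(\<alpha> ^ n / z) = 1\<close>, where \<open>\<psi>'\<close> has the conjugate coefficients
  (\<open>antiinversion_in_antiAut_iff\<close>). Absence of reflections gives the rest: \<open>\<alpha> ^ n = 1\<close> would make
  \<open>1 / cnj z\<close> an automorphism, and a relation \<open>\<psi>(z) = \<psi>'(cis \<theta> * z)\<close> would make some
  \<open>\<mu> * cnj z\<close> with \<open>\<bar>\<mu>\<bar> = 1\<close> one (\<open>scaled_cnj_in_antiAut\<close>).

  Conversely, let \<open>Q z = \<alpha> / cnj z\<close> be an automorphism with \<open>\<bar>\<alpha>\<bar> = 1\<close> and \<open>\<alpha> ^ n \<noteq> 1\<close>. By counting,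
  the rotations are all the holomorphic automorphisms, so a reflection \<open>R\<close> among the
  automorphisms satisfies \<open>R \<circ> Q = (z \<mapsto> w z)\<close> with \<open>w ^ n = 1\<close>; a fixed point of \<open>R\<close> then forces
  \<open>\<alpha> = w\<close>, a contradiction (\<open>pseudo_real_equivariant\<close>).

  To pass between identities in the field \<open>\<complex>(z)\<close> and equalities of self-maps of the sphere,
  everything is compared at all but finitely many points of the plane: such agreement determines
  an element of \<open>\<complex>(z)\<close> (\<open>rat_val_eqI\<close>), and also a self-map of the sphere given by homogeneous
  polynomials (\<open>rational_eqI\<close>), a class that contains all rational maps and is closed under
  composition with Moebius maps on both sides.
\<close>

section \<open>Rational functions as functions on almost all of the plane\<close>

text \<open>At a pole the value is \<open>0\<close>, by the convention for division. Up to finitely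
  many points, \<open>rat_val\<close> behaves as a field homomorphism.\<close>

definition rat_val :: "ratfun \<Rightarrow> complex \<Rightarrow> complex" where
  "rat_val f z = (case quot_of_fract f of (p, q) \<Rightarrow> poly p z / poly q z)"

lemma eventually_poly_nonzero:
  fixes p :: "complex poly"
  assumes "p \<noteq> 0"
  shows "\<forall>\<^sub>F z in cofinite. poly p z \<noteq> 0"
  using poly_roots_finite[OF assms] by (simp add: eventually_cofinite)

lemma poly_eqI_cofinite:
  fixes p q :: "complex poly"
  assumes "\<forall>\<^sub>F z in cofinite. poly p z = poly q z"
  shows "p = q"
proof (rule ccontr)
  assume "p \<noteq> q"
  then have "\<forall>\<^sub>F z in cofinite. poly (p - q) z \<noteq> 0"
    by (intro eventually_poly_nonzero) simp
  with assms have "\<forall>\<^sub>F z :: complex in cofinite. False"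
    by eventually_elim simp
  then show False
    by (simp add: eventually_cofinite infinite_UNIV_char_0)
qed

text \<open>An identity valid at almost all points may be transported along maps such as \<open>z \<mapsto> z ^ n\<close>,
  \<open>z \<mapsto> c * z\<close>, \<open>z \<mapsto> c / z\<close> and \<open>cnj\<close>, because finitely many exceptions have only finitely many
  preimages; surjectivity allows the transport in the opposite direction.\<close>

lemma filterlim_cofinite_finite_fibres:
  fixes h :: "'a \<Rightarrow> 'b"
  assumes "\<And>w. finite (h -` {w})"
  shows "filterlim h cofinite cofinite"
  unfolding filterlim_iff
proof (intro allI impI)
  fix P :: "'b \<Rightarrow> bool"
  assume "\<forall>\<^sub>F w in cofinite. P w"
  then have "finite (\<Union>w\<in>{w. \<not> P w}. h -` {w})"
    using assms by (auto simp: eventually_cofinite)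
  then show "\<forall>\<^sub>F z in cofinite. P (h z)"
    unfolding eventually_cofinite by (rule rev_finite_subset) auto
qed

lemma filterlim_cofinite_inj: "inj h \<Longrightarrow> filterlim h cofinite cofinite"
  by (intro filterlim_cofinite_finite_fibres finite_vimageI) auto

lemma eventually_cofinite_surjD:
  assumes "surj h" and "\<forall>\<^sub>F z in cofinite. P (h z)"
  shows "\<forall>\<^sub>F w in cofinite. P w"
proof -
  have "{w. \<not> P w} \<subseteq> h ` {z. \<not> P (h z)}"
  proof
    fix w assume "w \<in> {w. \<not> P w}"
    moreover obtain z where "w = h z" using assms(1) by (rule surjE)
    ultimately show "w \<in> h ` {z. \<not> P (h z)}" by simp
  qed
  then show ?thesis
    using assms(2) unfolding eventually_cofinite by (meson finite_imageI finite_subset)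
qed

lemma filterlim_cofinite_power:
  assumes "n > 0"
  shows "filterlim (\<lambda>z :: complex. z ^ n) cofinite cofinite"
proof (rule filterlim_cofinite_finite_fibres)
  fix w :: complex
  have "monom 1 n - [:w:] \<noteq> 0"
    using assms by (metis coeff_monom coeff_pCons_0 degree_monom_eq degree_pCons_0 eq_iff_diff_eq_0 neq0_conv zero_neq_one)
  from poly_roots_finite[OF this] show "finite ((\<lambda>z. z ^ n) -` {w})"
    by (rule rev_finite_subset) (auto simp: poly_monom)
qed

lemma surj_power:
  assumes "n > 0"
  shows "surj (\<lambda>z :: complex. z ^ n)"
proof (rule surjI)
  fix w :: complex
  have "card {z. z ^ n = w} > 0 \<or> w = 0"
    using card_nth_roots[of w n] assms by auto
  then have "\<exists>z. z ^ n = w"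
    using assms by (metis (mono_tags, lifting) Collect_empty_eq card.empty less_irrefl zero_power)
  then show "(SOME z. z ^ n = w) ^ n = w" by (rule someI_ex)
qed

lemma rat_val_Fract:
  assumes "q \<noteq> 0"
  shows "\<forall>\<^sub>F z in cofinite. rat_val (Fract p q) z = poly p z / poly q z"
proof -
  obtain a b where ab: "quot_of_fract (Fract p q) = (a, b)" by fastforce
  have b: "b \<noteq> 0"
    using snd_quot_of_fract_nonzero[of "Fract p q"] ab by simp
  have "Fract a b = Fract p q"
    using Fract_quot_of_fract[of "Fract p q"] ab by simp
  then have "a * q = p * b"
    using b assms by (simp add: eq_fract)
  then have eq: "poly a z * poly q z = poly p z * poly b z" for z
    by (metis poly_mult)
  show ?thesis
    using eventually_poly_nonzero[OF b] eventually_poly_nonzero[OF assms]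
    by eventually_elim (simp add: rat_val_def ab frac_eq_eq eq)
qed

lemma rat_val_eqI:
  assumes "\<forall>\<^sub>F z in cofinite. rat_val f z = rat_val g z"
  shows "f = g"
proof -
  obtain a b where ab: "quot_of_fract f = (a, b)" by fastforce
  obtain p q where pq: "quot_of_fract g = (p, q)" by fastforce
  have b: "b \<noteq> 0"
    using snd_quot_of_fract_nonzero[of f] ab by simp
  have q: "q \<noteq> 0"
    using snd_quot_of_fract_nonzero[of g] pq by simp
  have "\<forall>\<^sub>F z in cofinite. poly (a * q) z = poly (p * b) z"
    using eventually_poly_nonzero[OF b] eventually_poly_nonzero[OF q] assms
    by eventually_elim (simp add: rat_val_def ab pq frac_eq_eq)
  then have "a * q = p * b" by (rule poly_eqI_cofinite)
  then have "Fract a b = Fract p q"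
    using b q by (simp add: eq_fract)
  then show ?thesis
    using Fract_quot_of_fract[of f] Fract_quot_of_fract[of g] ab pq by simp
qed

lemma rat_val_to_fract: "\<forall>\<^sub>F z in cofinite. rat_val (to_fract p) z = poly p z"
  using rat_val_Fract[of 1 p] by (simp add: to_fract_def)

lemma rat_val_add: "\<forall>\<^sub>F z in cofinite. rat_val (f + g) z = rat_val f z + rat_val g z"
proof -
  obtain a b where f: "f = Fract a b" "b \<noteq> 0" by (cases f)
  obtain p q where g: "g = Fract p q" "q \<noteq> 0" by (cases g)
  have "f + g = Fract (a * q + p * b) (b * q)"
    using f g by simp
  then have "\<forall>\<^sub>F z in cofinite. rat_val (f + g) z = poly (a * q + p * b) z / poly (b * q) z"
    using rat_val_Fract[of "b * q" "a * q + p * b"] f g by simp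
  then show ?thesis
    using rat_val_Fract[OF f(2), of a] rat_val_Fract[OF g(2), of p]
      eventually_poly_nonzero[OF f(2)] eventually_poly_nonzero[OF g(2)]
    by eventually_elim (simp add: f g add_frac_eq)
qed

lemma rat_val_mult: "\<forall>\<^sub>F z in cofinite. rat_val (f * g) z = rat_val f z * rat_val g z"
proof -
  obtain a b where f: "f = Fract a b" "b \<noteq> 0" by (cases f)
  obtain p q where g: "g = Fract p q" "q \<noteq> 0" by (cases g)
  have "f * g = Fract (a * p) (b * q)"
    using f g by simp
  then have "\<forall>\<^sub>F z in cofinite. rat_val (f * g) z = poly (a * p) z / poly (b * q) z"
    using rat_val_Fract[of "b * q" "a * p"] f g by simp
  then show ?thesis
    using rat_val_Fract[OF f(2), of a] rat_val_Fract[OF g(2), of p]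
    by eventually_elim (simp add: f g)
qed

lemma rat_val_inverse: "\<forall>\<^sub>F z in cofinite. rat_val (inverse f) z = inverse (rat_val f z)"
proof (cases "f = 0")
  case True
  then show ?thesis by (simp add: rat_val_def)
next
  case False
  obtain a b where f: "f = Fract a b" "b \<noteq> 0" by (cases f)
  have "a \<noteq> 0" using False f by (auto simp: fract_collapse)
  moreover have "inverse f = Fract b a"
    using f by simp
  ultimately have "\<forall>\<^sub>F z in cofinite. rat_val (inverse f) z = poly b z / poly a z"
    using rat_val_Fract by simp
  then show ?thesis
    using rat_val_Fract[OF f(2), of a]
    by eventually_elim (simp add: f)
qed

lemma rat_val_divide: "\<forall>\<^sub>F z in cofinite. rat_val (f / g) z = rat_val f z / rat_val g z"
  using rat_val_mult[of f "inverse g"] rat_val_inverse[of g]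
  by eventually_elim (simp add: field_class.field_divide_inverse divide_inverse)

lemma rat_val_poly_comp:
  "\<forall>\<^sub>F z in cofinite. rat_val (poly (map_poly rat_const p) g) z = poly p (rat_val g z)"
proof (induction p)
  case 0
  then show ?case by (simp add: rat_val_def)
next
  case (pCons c p)
  have "poly (map_poly rat_const (pCons c p)) g
      = rat_const c + g * poly (map_poly rat_const p) g"
    by (simp add: map_poly_pCons)
  show ?case
    using pCons.IH rat_val_mult[of g "poly (map_poly rat_const p) g"]
      rat_val_to_fract[of "[:c:]"] rat_val_add[of "rat_const c" "g * poly (map_poly rat_const p) g"]
    unfolding \<open>poly (map_poly rat_const (pCons c p)) g = _\<close>
    by eventually_elim simp
qed

text \<open>Numerator and denominator are evaluated separately and the quotient is formed pointwise. For
  constant \<open>g\<close> at a pole of \<open>f\<close> both sides are \<open>0\<close>, by the convention for division.\<close>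

lemma rat_val_comp:
  "\<forall>\<^sub>F z in cofinite. rat_val (rat_comp f g) z = rat_val f (rat_val g z)"
proof -
  obtain p q where pq: "quot_of_fract f = (p, q)" by fastforce
  show ?thesis
    using rat_val_poly_comp[of p g] rat_val_poly_comp[of q g]
      rat_val_divide[of "poly (map_poly rat_const p) g" "poly (map_poly rat_const q) g"]
    by eventually_elim (simp add: rat_comp_def pq, simp add: rat_val_def pq)
qed

lemma rat_val_rat_cnj: "rat_val (rat_cnj f) z = cnj (rat_val f (cnj z))"
proof -
  obtain p q where pq: "quot_of_fract f = (p, q)" by fastforce
  show ?thesis
    by (simp add: rat_val_def pq quot_of_fract_rat_cnj[OF pq] poly_map_poly_cnj)
qed

lemma rat_val_rat_var_power: "\<forall>\<^sub>F z in cofinite. rat_val (rat_var ^ n) z = z ^ n"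
proof (induction n)
  case 0
  then show ?case using rat_val_to_fract[of 1] by simp
next
  case (Suc n)
  show ?case
    using Suc rat_val_mult[of rat_var "rat_var ^ n"] rat_val_to_fract[of "[:0, 1:]"]
    by eventually_elim simp
qed

lemma rat_map_eq_rat_val: "\<forall>\<^sub>F z in cofinite. rat_map f (Pt z) = Pt (rat_val f z)"
proof -
  obtain p q where pq: "quot_of_fract f = (p, q)" by fastforce
  have "q \<noteq> 0" using snd_quot_of_fract_nonzero[of f] pq by simp
  from eventually_poly_nonzero[OF this] show ?thesis
    by eventually_elim (simp add: pq rat_val_def)
qed


section \<open>Homogeneous coordinates\<close>

definition proj :: "complex \<Rightarrow> complex \<Rightarrow> csphere" where
  "proj x y = (if y = 0 then Inf else Pt (x / y))"

lemma csphere_projE: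
  obtains x y where "(x, y) \<noteq> (0, 0)" "s = proj x y"
proof (cases s)
  case (Pt z)
  then show ?thesis using that[of z 1] by (simp add: proj_def)
next
  case Inf
  then show ?thesis using that[of 1 0] by (simp add: proj_def)
qed

text \<open>Equality in homogeneous coordinates is proportionality. This makes equality of two rational
  maps a polynomial identity, without a case distinction at infinity.\<close>

lemma proj_eq_iff:
  assumes "(x, y) \<noteq> (0, 0)" "(u, v) \<noteq> (0, 0)"
  shows "proj x y = proj u v \<longleftrightarrow> x * v = u * y"
  using assms unfolding proj_def by (cases "y = 0"; cases "v = 0"; simp add: frac_eq_eq)

lemma proj_divide: "k \<noteq> 0 \<Longrightarrow> proj (x / k) (y / k) = proj x y"
  by (simp add: proj_def)

lemma moebius_proj:
  assumes "a * d - b * c \<noteq> 0" "(x, y) \<noteq> (0, 0)"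
  shows "moebius a b c d (proj x y) = proj (a * x + b * y) (c * x + d * y)"
proof (cases "y = 0")
  case True
  then show ?thesis using assms by (auto simp: proj_def)
next
  case False
  have eq: "c * (x / y) + d = (c * x + d * y) / y" "a * (x / y) + b = (a * x + b * y) / y"
    using False by (simp_all add: add_divide_distrib)
  have "moebius a b c d (Pt (x / y)) = proj ((a * x + b * y) / y) ((c * x + d * y) / y)"
    unfolding moebius.simps eq proj_def ..
  also have "\<dots> = proj (a * x + b * y) (c * x + d * y)"
    using False by (rule proj_divide)
  finally show ?thesis using False by (simp add: proj_def)
qed

lemma linear_nonzero:
  fixes a b c d x y :: complex
  assumes "a * d - b * c \<noteq> 0" "(x, y) \<noteq> (0, 0)"
  shows "(a * x + b * y, c * x + d * y) \<noteq> (0, 0)"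
proof
  assume *: "(a * x + b * y, c * x + d * y) = (0, 0)"
  then have 0: "a * x + b * y = 0" "c * x + d * y = 0"
    unfolding prod.inject by blast+
  have "(a * d - b * c) * x = d * (a * x + b * y) - b * (c * x + d * y)"
    "(a * d - b * c) * y = a * (c * x + d * y) - c * (a * x + b * y)"
    by (simp_all add: algebra_simps)
  then have "(a * d - b * c) * x = 0" "(a * d - b * c) * y = 0"
    unfolding 0 by simp_all
  then have "x = 0" "y = 0"
    using assms(1) unfolding mult_eq_0_iff by blast+
  then show False using assms(2) by simp
qed

text \<open>The value at \<open>(x, y)\<close> of the homogenization of \<open>p\<close> to degree \<open>N\<close>, for \<open>degree p \<le> N\<close>.\<close>

definition hom_eval :: "nat \<Rightarrow> complex poly \<Rightarrow> complex \<Rightarrow> complex \<Rightarrow> complex" where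
  "hom_eval N p x y = (\<Sum>i\<le>N. coeff p i * x ^ i * y ^ (N - i))"

lemma hom_eval_affine:
  assumes "degree p \<le> N" "y \<noteq> 0"
  shows "hom_eval N p x y = y ^ N * poly p (x / y)"
proof -
  have "poly p (x / y) = (\<Sum>i\<le>N. coeff p i * (x / y) ^ i)"
    unfolding poly_altdef using assms(1)
    by (intro sum.mono_neutral_left) (auto simp: coeff_eq_0)
  then show ?thesis
    unfolding hom_eval_def using assms(2)
    by (auto simp: sum_distrib_left power_divide power_diff intro!: sum.cong)
qed

lemma hom_eval_Inf: "hom_eval N p x 0 = coeff p N * x ^ N"
proof -
  have "hom_eval N p x 0 = (\<Sum>i\<le>N. if i = N then coeff p N * x ^ N else 0)"
    unfolding hom_eval_def by (intro sum.cong) auto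
  then show ?thesis by simp
qed

lemma hom_eval_add: "hom_eval N (p + q) x y = hom_eval N p x y + hom_eval N q x y"
  by (simp add: hom_eval_def algebra_simps sum.distrib)

lemma hom_eval_smult: "hom_eval N (smult c p) x y = c * hom_eval N p x y"
  by (simp add: hom_eval_def sum_distrib_left mult.assoc)

lemma hom_eval_sum: "hom_eval N (\<Sum>i\<in>A. p i) x y = (\<Sum>i\<in>A. hom_eval N (p i) x y)"
  by (induction A rule: infinite_finite_induct) (simp_all add: hom_eval_add, simp_all add: hom_eval_def)

lemma coeff_mult_degree_le:
  fixes p q :: "'a :: comm_semiring_0 poly"
  assumes "degree p \<le> M" "degree q \<le> N"
  shows "coeff (p * q) (M + N) = coeff p M * coeff q N"
proof -
  have "coeff (p * q) (M + N) = (\<Sum>i\<le>M + N. if i = M then coeff p M * coeff q N else 0)"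
    unfolding coeff_mult
  proof (intro sum.cong refl)
    fix i assume "i \<in> {..M + N}"
    then have "i > M \<or> M + N - i > N \<or> i = M" by auto
    then show "coeff p i * coeff q (M + N - i) = (if i = M then coeff p M * coeff q N else 0)"
      using assms by (auto simp: coeff_eq_0)
  qed
  then show ?thesis by simp
qed

lemma hom_eval_mult:
  assumes "degree p \<le> M" "degree q \<le> N"
  shows "hom_eval (M + N) (p * q) x y = hom_eval M p x y * hom_eval N q x y"
proof (cases "y = 0")
  case True
  then show ?thesis
    using assms by (simp add: hom_eval_Inf coeff_mult_degree_le power_add)
next
  case False
  moreover have "degree (p * q) \<le> M + N"
    using assms degree_mult_le[of p q] by linarith
  ultimately show ?thesis
    using assms by (simp add: hom_eval_affine power_add)
qed

lemma hom_eval_linear: "hom_eval 1 [:b, a:] x y = a * x + b * y"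
  by (simp add: hom_eval_def)

lemma hom_eval_linear_power:
  "degree ([:b, a:] ^ i) \<le> i \<and> hom_eval i ([:b, a:] ^ i) x y = (a * x + b * y) ^ i"
proof (induction i)
  case 0
  then show ?case by (simp add: hom_eval_def)
next
  case (Suc i)
  have "degree [:b, a:] \<le> 1" by simp
  moreover have "degree ([:b, a:] * [:b, a:] ^ i) \<le> 1 + i"
    using Suc degree_mult_le[of "[:b, a:]" "[:b, a:] ^ i"] \<open>degree [:b, a:] \<le> 1\<close> by linarith
  ultimately show ?case
    using Suc hom_eval_mult[of "[:b, a:]" 1 "[:b, a:] ^ i" i] hom_eval_linear by simp
qed

text \<open>A linear substitution in a form of degree \<open>N\<close> is a form of degree \<open>N\<close>: each monomial becomes
  a product of \<open>N\<close> linear forms.\<close>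

lemma hom_eval_substitution:
  obtains p' where "degree p' \<le> N"
    "\<And>x y. hom_eval N p' x y = hom_eval N p (a * x + b * y) (c * x + d * y)"
proof
  let ?p = "\<Sum>i\<le>N. smult (coeff p i) ([:b, a:] ^ i * [:d, c:] ^ (N - i))"
  have deg: "degree ([:b, a:] ^ i * [:d, c:] ^ (N - i)) \<le> N" if "i \<le> N" for i
  proof -
    have "degree ([:b, a:] ^ i) \<le> i" "degree ([:d, c:] ^ (N - i)) \<le> N - i"
      using hom_eval_linear_power by blast+
    then show ?thesis
      using that degree_mult_le[of "[:b, a:] ^ i" "[:d, c:] ^ (N - i)"] by linarith
  qed
  show "degree ?p \<le> N"
    by (intro degree_sum_le order.trans[OF degree_smult_le] deg) auto
  fix x y
  have "hom_eval N ([:b, a:] ^ i * [:d, c:] ^ (N - i)) x y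
      = (a * x + b * y) ^ i * (c * x + d * y) ^ (N - i)" if "i \<le> N" for i
    using that hom_eval_linear_power[of b a i x y] hom_eval_linear_power[of d c "N - i" x y]
      hom_eval_mult[of "[:b, a:] ^ i" i "[:d, c:] ^ (N - i)" "N - i" x y] by simp
  then show "hom_eval N ?p x y = hom_eval N p (a * x + b * y) (c * x + d * y)"
    unfolding hom_eval_sum hom_eval_smult
    by (simp add: hom_eval_def mult.assoc)
qed


section \<open>Rational self-maps of the sphere\<close>

text \<open>The absence of a common zero in homogeneous coordinates replaces both coprimality of \<open>p\<close> and
  \<open>q\<close> and the equation \<open>N = max (degree p) (degree q)\<close>. In this form the condition is obviously
  preserved by invertible linear changes of coordinates in source and target.\<close>

definition hom_rep :: "nat \<Rightarrow> complex poly \<Rightarrow> complex poly \<Rightarrow> (csphere \<Rightarrow> csphere) \<Rightarrow> bool" where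
  "hom_rep N p q F \<longleftrightarrow> degree p \<le> N \<and> degree q \<le> N \<and>
     (\<forall>x y. (x, y) \<noteq> (0, 0) \<longrightarrow> (hom_eval N p x y, hom_eval N q x y) \<noteq> (0, 0) \<and>
        F (proj x y) = proj (hom_eval N p x y) (hom_eval N q x y))"

text \<open>Besides the maps \<open>rat_map f\<close> this includes the constant map with value \<open>Inf\<close>, so that the class
  is closed under composition with Moebius maps.\<close>

definition rational :: "(csphere \<Rightarrow> csphere) \<Rightarrow> bool" where
  "rational F \<longleftrightarrow> (\<exists>N p q. hom_rep N p q F)"

lemma hom_rep_affine:
  assumes "hom_rep N p q F"
  shows "F (Pt z) = proj (poly p z) (poly q z)" "(poly p z, poly q z) \<noteq> (0, 0)"
proof -
  have "hom_eval N p z 1 = poly p z" "hom_eval N q z 1 = poly q z" "proj z 1 = Pt z"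
    using assms by (simp_all add: hom_rep_def hom_eval_affine proj_def)
  moreover have "(z, 1) \<noteq> (0, 0 :: complex)" by simp
  ultimately show "F (Pt z) = proj (poly p z) (poly q z)" "(poly p z, poly q z) \<noteq> (0, 0)"
    using assms unfolding hom_rep_def by metis+
qed

lemma rational_rat_map: "rational (rat_map f)"
proof -
  obtain p q where pq: "quot_of_fract f = (p, q)" by fastforce
  let ?N = "max (degree p) (degree q)"
  have q: "q \<noteq> 0" and cop: "coprime p q"
    using snd_quot_of_fract_nonzero[of f] coprime_quot_of_fract[of f] pq by simp_all
  have no_common_root: "poly p z \<noteq> 0 \<or> poly q z \<noteq> 0" for z
  proof (rule ccontr)
    assume "\<not> ?thesis"
    then have "[:- z, 1:] dvd p" "[:- z, 1:] dvd q" by (simp_all add: poly_eq_0_iff_dvd)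
    then have "is_unit [:- z, 1:]" using cop coprime_common_divisor by blast
    then show False by (simp add: is_unit_iff_degree)
  qed
  have "hom_rep ?N p q (rat_map f)"
    unfolding hom_rep_def
  proof (intro conjI allI impI)
    fix x y :: complex
    assume xy: "(x, y) \<noteq> (0, 0)"
    have "(hom_eval ?N p x y, hom_eval ?N q x y) \<noteq> (0, 0) \<and>
        rat_map f (proj x y) = proj (hom_eval ?N p x y) (hom_eval ?N q x y)"
    proof (cases "y = 0")
      case False
      then show ?thesis
        using no_common_root[of "x / y"] by (auto simp: hom_eval_affine pq proj_def)
    next
      case True
      then have x: "x \<noteq> 0" using xy by simp
      show ?thesis
      proof (cases "degree p > degree q")
        case True
        then have "coeff p (degree p) \<noteq> 0" "coeff q (degree p) = 0" "max (degree p) (degree q) = degree p"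
          by (auto simp: coeff_eq_0)
        then show ?thesis using \<open>y = 0\<close> x True
          by (simp add: hom_eval_Inf pq proj_def)
      next
        case False
        then have "coeff q (degree q) \<noteq> 0" "max (degree p) (degree q) = degree q"
          using q by auto
        then show ?thesis using \<open>y = 0\<close> x False
          by (simp add: hom_eval_Inf pq proj_def)
      qed
    qed
    then show "(hom_eval ?N p x y, hom_eval ?N q x y) \<noteq> (0, 0)"
        "rat_map f (proj x y) = proj (hom_eval ?N p x y) (hom_eval ?N q x y)" by auto
  qed auto
  then show ?thesis unfolding rational_def by blast
qed

text \<open>Let \<open>F\<close> and \<open>G\<close> be given by \<open>(p, q)\<close> and \<open>(a, b)\<close>. Agreement at almost all
  points makes the polynomials \<open>p * b\<close> and \<open>a * q\<close> equal, and these decide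
  equality of the two maps at every point, including infinity.\<close>

lemma rational_eqI:
  assumes "rational F" "rational G" "\<forall>\<^sub>F z in cofinite. F (Pt z) = G (Pt z)"
  shows "F = G"
proof
  fix s
  obtain N p q where F: "hom_rep N p q F" using assms(1) unfolding rational_def by blast
  obtain M a b where G: "hom_rep M a b G" using assms(2) unfolding rational_def by blast
  have "\<forall>\<^sub>F z in cofinite. poly (p * b) z = poly (a * q) z"
    using assms(3)
  proof eventually_elim
    case (elim z)
    then show ?case
      using proj_eq_iff[OF hom_rep_affine(2)[OF F, of z] hom_rep_affine(2)[OF G, of z]]
        hom_rep_affine(1)[OF F, of z] hom_rep_affine(1)[OF G, of z] by simp
  qed
  then have eq: "p * b = a * q" by (rule poly_eqI_cofinite)
  obtain x y where xy: "(x, y) \<noteq> (0, 0)" "s = proj x y" by (rule csphere_projE)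
  have "hom_eval N p x y * hom_eval M b x y = hom_eval M a x y * hom_eval N q x y"
    using F G eq hom_eval_mult[of p N b M x y] hom_eval_mult[of a M q N x y]
    by (simp add: hom_rep_def add.commute)
  then show "F s = G s"
    using F G xy proj_eq_iff unfolding hom_rep_def by simp
qed

lemma rational_cases:
  assumes "rational F"
  obtains "\<And>s. F s = Inf" | f where "F = rat_map f"
proof -
  obtain N p q where F: "hom_rep N p q F" using assms(1) unfolding rational_def by blast
  show ?thesis
  proof (cases "q = 0")
    case True
    have "F s = Inf" for s
    proof -
      obtain x y where xy: "(x, y) \<noteq> (0, 0)" "s = proj x y" by (rule csphere_projE)
      then show ?thesis using F True by (simp add: hom_rep_def proj_def hom_eval_def)
    qed
    then show ?thesis using that by blast
  next
    case False
    have "\<forall>\<^sub>F z in cofinite. F (Pt z) = rat_map (Fract p q) (Pt z)"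
      using rat_map_eq_rat_val[of "Fract p q"] rat_val_Fract[OF False, of p]
        eventually_poly_nonzero[OF False]
      by eventually_elim (simp add: hom_rep_affine(1)[OF F] proj_def)
    then have "F = rat_map (Fract p q)"
      using assms rational_rat_map by (rule rational_eqI[rotated -1])
    then show ?thesis using that by blast
  qed
qed

lemma rational_moebius_comp:
  assumes "rational F" "a * d - b * c \<noteq> 0"
  shows "rational (moebius a b c d \<circ> F)"
proof -
  obtain N p q where F: "hom_rep N p q F" using assms(1) unfolding rational_def by blast
  have "hom_rep N (smult a p + smult b q) (smult c p + smult d q) (moebius a b c d \<circ> F)"
    unfolding hom_rep_def
  proof (intro conjI allI impI)
    show "degree (smult a p + smult b q) \<le> N" "degree (smult c p + smult d q) \<le> N"
      using F by (auto simp: hom_rep_def intro!: degree_add_le order.trans[OF degree_smult_le])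
  next
    fix x y :: complex
    assume "(x, y) \<noteq> (0, 0)"
    with F have nz: "(hom_eval N p x y, hom_eval N q x y) \<noteq> (0, 0)"
      and eq: "F (proj x y) = proj (hom_eval N p x y) (hom_eval N q x y)"
      unfolding hom_rep_def by blast+
    show "(hom_eval N (smult a p + smult b q) x y, hom_eval N (smult c p + smult d q) x y) \<noteq> (0, 0)"
      unfolding hom_eval_add hom_eval_smult by (rule linear_nonzero[OF assms(2) nz])
    show "(moebius a b c d \<circ> F) (proj x y) =
        proj (hom_eval N (smult a p + smult b q) x y) (hom_eval N (smult c p + smult d q) x y)"
      unfolding hom_eval_add hom_eval_smult comp_apply eq by (rule moebius_proj[OF assms(2) nz])
  qed
  then show ?thesis unfolding rational_def by blast
qed

lemma rational_comp_moebius: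
  assumes "rational F" "a * d - b * c \<noteq> 0"
  shows "rational (F \<circ> moebius a b c d)"
proof -
  obtain N p q where F: "hom_rep N p q F" using assms(1) unfolding rational_def by blast
  obtain p' where p': "degree p' \<le> N"
    "\<And>x y. hom_eval N p' x y = hom_eval N p (a * x + b * y) (c * x + d * y)"
    using hom_eval_substitution[of N p a b c d] by blast
  obtain q' where q': "degree q' \<le> N"
    "\<And>x y. hom_eval N q' x y = hom_eval N q (a * x + b * y) (c * x + d * y)"
    using hom_eval_substitution[of N q a b c d] by blast
  have "hom_rep N p' q' (F \<circ> moebius a b c d)"
    unfolding hom_rep_def
  proof (intro conjI allI impI p'(1) q'(1))
    fix x y :: complex
    assume xy: "(x, y) \<noteq> (0, 0)"
    show "(hom_eval N p' x y, hom_eval N q' x y) \<noteq> (0, 0)"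
      using F linear_nonzero[OF assms(2) xy] unfolding hom_rep_def p' q' by blast
    show "(F \<circ> moebius a b c d) (proj x y) = proj (hom_eval N p' x y) (hom_eval N q' x y)"
      using F linear_nonzero[OF assms(2) xy]
      unfolding hom_rep_def p' q' comp_apply moebius_proj[OF assms(2) xy] by blast
  qed
  then show ?thesis unfolding rational_def by blast
qed


section \<open>Moebius and anti-Moebius maps\<close>

lemma moebius_comp:
  assumes "a * d - b * c \<noteq> 0" "a' * d' - b' * c' \<noteq> 0"
  shows "moebius a b c d \<circ> moebius a' b' c' d' =
    moebius (a * a' + b * c') (a * b' + b * d') (c * a' + d * c') (c * b' + d * d')"
proof
  fix s
  obtain x y where xy: "(x, y) \<noteq> (0, 0)" "s = proj x y" by (rule csphere_projE)
  have "(a * a' + b * c') * (c * b' + d * d') - (a * b' + b * d') * (c * a' + d * c')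
      = (a * d - b * c) * (a' * d' - b' * c')"
    by (simp add: algebra_simps)
  with assms have "(a * a' + b * c') * (c * b' + d * d') - (a * b' + b * d') * (c * a' + d * c') \<noteq> 0"
    by (metis mult_eq_0_iff)
  from moebius_proj[OF this xy(1)] show "(moebius a b c d \<circ> moebius a' b' c' d') s =
      moebius (a * a' + b * c') (a * b' + b * d') (c * a' + d * c') (c * b' + d * d') s"
    unfolding xy(2) comp_apply moebius_proj[OF assms(2) xy(1)]
      moebius_proj[OF assms(1) linear_nonzero[OF assms(2) xy(1)]]
    by (simp add: algebra_simps)
qed

lemma moebius_id: "moebius k 0 0 k = id" if "k \<noteq> 0"
proof
  fix s show "moebius k 0 0 k s = id s" using that by (cases s) simp_all
qed

lemma moebius_scale:
  assumes "k \<noteq> 0"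
  shows "moebius (k * a) (k * b) (k * c) (k * d) = moebius a b c d"
proof
  fix s
  have "k * a * z + k * b = k * (a * z + b)" "k * c * z + k * d = k * (c * z + d)" for z
    by (simp_all add: algebra_simps)
  then show "moebius (k * a) (k * b) (k * c) (k * d) s = moebius a b c d s"
    using assms by (cases s) simp_all
qed

text \<open>A complex matrix can be rescaled to determinant \<open>1\<close> because its determinant has a square root.\<close>

lemma PSL2C_iff: "T \<in> PSL2C \<longleftrightarrow> (\<exists>a b c d. a * d - b * c \<noteq> 0 \<and> T = moebius a b c d)"
proof
  assume "T \<in> PSL2C"
  then show "\<exists>a b c d. a * d - b * c \<noteq> 0 \<and> T = moebius a b c d"
    unfolding PSL2C_def by force
next
  assume "\<exists>a b c d. a * d - b * c \<noteq> 0 \<and> T = moebius a b c d"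
  then obtain a b c d where nz: "a * d - b * c \<noteq> 0" and T: "T = moebius a b c d" by blast
  define k where "k = inverse (csqrt (a * d - b * c))"
  have k: "k \<noteq> 0" "k\<^sup>2 * (a * d - b * c) = 1"
    using nz by (simp_all add: k_def power_inverse)
  then have "k * a * (k * d) - k * b * (k * c) = 1"
    by (simp add: algebra_simps power2_eq_square)
  moreover have "T = moebius (k * a) (k * b) (k * c) (k * d)"
    unfolding T using moebius_scale[OF k(1)] by simp
  ultimately show "T \<in> PSL2C" unfolding PSL2C_def by blast
qed

lemma moebius_in_PSL2C: "a * d - b * c \<noteq> 0 \<Longrightarrow> moebius a b c d \<in> PSL2C"
  unfolding PSL2C_iff by blast

lemma id_in_PSL2C: "id \<in> PSL2C"
  using moebius_in_PSL2C[of 1 1 0 0] moebius_id[of 1] by simp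

lemma PSL2C_comp:
  assumes "S \<in> PSL2C" "T \<in> PSL2C"
  shows "S \<circ> T \<in> PSL2C"
proof -
  obtain a b c d where S: "a * d - b * c \<noteq> 0" "S = moebius a b c d"
    using assms(1) unfolding PSL2C_iff by blast
  obtain a' b' c' d' where T: "a' * d' - b' * c' \<noteq> 0" "T = moebius a' b' c' d'"
    using assms(2) unfolding PSL2C_iff by blast
  have "(a * a' + b * c') * (c * b' + d * d') - (a * b' + b * d') * (c * a' + d * c')
      = (a * d - b * c) * (a' * d' - b' * c')"
    by (simp add: algebra_simps)
  with S T have "(a * a' + b * c') * (c * b' + d * d') - (a * b' + b * d') * (c * a' + d * c') \<noteq> 0"
    by (metis mult_eq_0_iff)
  then show ?thesis
    unfolding S(2) T(2) moebius_comp[OF S(1) T(1)] by (rule moebius_in_PSL2C)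
qed

lemma moebius_inverse:
  assumes "a * d - b * c \<noteq> 0"
  shows "moebius a b c d \<circ> moebius d (- b) (- c) a = id"
    "moebius d (- b) (- c) a \<circ> moebius a b c d = id"
proof -
  have *: "d * a - - b * - c \<noteq> 0" using assms by (simp add: algebra_simps)
  show "moebius a b c d \<circ> moebius d (- b) (- c) a = id"
    unfolding moebius_comp[OF assms *]
    using moebius_id[OF assms] by (simp add: algebra_simps)
  show "moebius d (- b) (- c) a \<circ> moebius a b c d = id"
    unfolding moebius_comp[OF * assms]
    using moebius_id[OF assms] by (simp add: algebra_simps)
qed

lemma inv_moebius:
  assumes "a * d - b * c \<noteq> 0"
  shows "inv_into UNIV (moebius a b c d) = moebius d (- b) (- c) a"
  using moebius_inverse[OF assms] by (simp add: inv_unique_comp)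

lemma PSL2C_bij: "T \<in> PSL2C \<Longrightarrow> bij T"
  unfolding PSL2C_iff using moebius_inverse o_bij by metis

lemma PSL2C_inv: "T \<in> PSL2C \<Longrightarrow> inv_into UNIV T \<in> PSL2C"
  unfolding PSL2C_iff by (metis inv_moebius minus_mult_minus mult.commute)

lemma sphere_cnj_involution: "sphere_cnj (sphere_cnj s) = s"
  by (cases s) simp_all

lemma bij_sphere_cnj: "bij sphere_cnj"
  using sphere_cnj_involution by (intro o_bij[of sphere_cnj]) auto

lemma sphere_cnj_moebius:
  "sphere_cnj \<circ> moebius a b c d = moebius (cnj a) (cnj b) (cnj c) (cnj d) \<circ> sphere_cnj"
proof
  fix s
  have "cnj c * cnj z + cnj d = cnj (c * z + d)" for z by simp
  then show "(sphere_cnj \<circ> moebius a b c d) s = (moebius (cnj a) (cnj b) (cnj c) (cnj d) \<circ> sphere_cnj) s"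
    by (cases s) (auto simp del: complex_cnj_add complex_cnj_mult, simp)
qed

text \<open>Complex conjugation normalizes \<open>PSL2C\<close>, so that \<open>PSL2C\<close> and \<open>antimoebius\<close> together form a group
  in which \<open>PSL2C\<close> has index two.\<close>

lemma sphere_cnj_PSL2C:
  assumes "T \<in> PSL2C"
  obtains T' where "T' \<in> PSL2C" "sphere_cnj \<circ> T = T' \<circ> sphere_cnj"
proof -
  obtain a b c d where T: "a * d - b * c \<noteq> 0" "T = moebius a b c d"
    using assms unfolding PSL2C_iff by blast
  have "cnj a * cnj d - cnj b * cnj c = cnj (a * d - b * c)" by simp
  then have "cnj a * cnj d - cnj b * cnj c \<noteq> 0" using T(1) by (metis complex_cnj_zero_iff)
  then show ?thesis
    using that[of "moebius (cnj a) (cnj b) (cnj c) (cnj d)"] sphere_cnj_moebius[of a b c d]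
      moebius_in_PSL2C unfolding T(2) by blast
qed

lemma antimoebius_bij: "Q \<in> antimoebius \<Longrightarrow> bij Q"
  unfolding antimoebius_def using PSL2C_bij bij_sphere_cnj bij_comp by blast

lemma PSL2C_comp_antimoebius: "T \<in> PSL2C \<Longrightarrow> Q \<in> antimoebius \<Longrightarrow> T \<circ> Q \<in> antimoebius"
  unfolding antimoebius_def using PSL2C_comp by (auto simp flip: comp_assoc)

lemma antimoebius_comp_PSL2C:
  assumes "Q \<in> antimoebius" "T \<in> PSL2C"
  shows "Q \<circ> T \<in> antimoebius"
proof -
  obtain S where S: "S \<in> PSL2C" "Q = S \<circ> sphere_cnj" using assms(1) unfolding antimoebius_def by blast
  obtain T' where T': "T' \<in> PSL2C" "sphere_cnj \<circ> T = T' \<circ> sphere_cnj"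
    using assms(2) by (rule sphere_cnj_PSL2C)
  have "Q \<circ> T = (S \<circ> T') \<circ> sphere_cnj" unfolding S(2) comp_assoc T'(2) ..
  then show ?thesis using PSL2C_comp[OF S(1) T'(1)] unfolding antimoebius_def by blast
qed

lemma antimoebius_comp_antimoebius:
  assumes "Q \<in> antimoebius" "R \<in> antimoebius"
  shows "Q \<circ> R \<in> PSL2C"
proof -
  obtain S where S: "S \<in> PSL2C" "Q = S \<circ> sphere_cnj" using assms(1) unfolding antimoebius_def by blast
  obtain T where T: "T \<in> PSL2C" "R = T \<circ> sphere_cnj" using assms(2) unfolding antimoebius_def by blast
  obtain T' where T': "T' \<in> PSL2C" "sphere_cnj \<circ> T = T' \<circ> sphere_cnj"
    using T(1) by (rule sphere_cnj_PSL2C)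
  have "Q \<circ> R = S \<circ> ((sphere_cnj \<circ> T) \<circ> sphere_cnj)"
    unfolding S(2) T(2) by (simp add: comp_assoc)
  also have "\<dots> = S \<circ> T'"
    unfolding T'(2) by (simp add: fun_eq_iff sphere_cnj_involution)
  finally show ?thesis using PSL2C_comp[OF S(1) T'(1)] by simp
qed

lemma antimoebius_inv:
  assumes "Q \<in> antimoebius"
  shows "inv_into UNIV Q \<in> antimoebius"
proof -
  obtain S where S: "S \<in> PSL2C" "Q = S \<circ> sphere_cnj" using assms unfolding antimoebius_def by blast
  obtain T' where T': "T' \<in> PSL2C" "sphere_cnj \<circ> inv_into UNIV S = T' \<circ> sphere_cnj"
    using PSL2C_inv[OF S(1)] by (rule sphere_cnj_PSL2C)
  have "inv_into UNIV Q = inv_into UNIV sphere_cnj \<circ> inv_into UNIV S"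
    unfolding S(2) by (rule o_inv_distrib[OF PSL2C_bij[OF S(1)] bij_sphere_cnj])
  also have "inv_into UNIV sphere_cnj = sphere_cnj"
    by (rule inv_unique_comp) (simp_all add: fun_eq_iff sphere_cnj_involution)
  finally have "inv_into UNIV Q = T' \<circ> sphere_cnj" unfolding T'(2) .
  then show ?thesis using T'(1) unfolding antimoebius_def by blast
qed

lemma rational_PSL2C_comp: "rational F \<Longrightarrow> T \<in> PSL2C \<Longrightarrow> rational (T \<circ> F)"
  unfolding PSL2C_iff using rational_moebius_comp by blast

lemma rational_comp_PSL2C: "rational F \<Longrightarrow> T \<in> PSL2C \<Longrightarrow> rational (F \<circ> T)"
  unfolding PSL2C_iff using rational_comp_moebius by blast


section \<open>Automorphisms and conjugation\<close>

text \<open>Automorphisms are handled from here on as the maps that commute with \<open>\<phi>\<close>.\<close>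

lemma conjugate_eq_iff:
  assumes "bij T"
  shows "T \<circ> \<phi> \<circ> inv_into UNIV T = \<phi> \<longleftrightarrow> (\<forall>s. T (\<phi> s) = \<phi> (T s))"
proof
  assume *: "T \<circ> \<phi> \<circ> inv_into UNIV T = \<phi>"
  show "\<forall>s. T (\<phi> s) = \<phi> (T s)"
  proof
    fix s
    show "T (\<phi> s) = \<phi> (T s)"
      using fun_cong[OF *, of "T s"] assms by (simp add: bij_is_inj inv_f_f)
  qed
next
  assume "\<forall>s. T (\<phi> s) = \<phi> (T s)"
  then show "T \<circ> \<phi> \<circ> inv_into UNIV T = \<phi>"
    using assms by (auto simp: fun_eq_iff bij_is_surj surj_f_inv_f)
qed

lemma Aut_iff: "T \<in> Aut \<phi> \<longleftrightarrow> T \<in> PSL2C \<and> (\<forall>s. T (\<phi> s) = \<phi> (T s))"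
  unfolding Aut_def using conjugate_eq_iff PSL2C_bij by blast

lemma antiAut_iff: "Q \<in> antiAut \<phi> \<longleftrightarrow> Q \<in> antimoebius \<and> (\<forall>s. Q (\<phi> s) = \<phi> (Q s))"
  unfolding antiAut_def using conjugate_eq_iff antimoebius_bij by blast

lemma Aut_comp_antiAut: "T \<in> Aut \<phi> \<Longrightarrow> Q \<in> antiAut \<phi> \<Longrightarrow> T \<circ> Q \<in> antiAut \<phi>"
  unfolding Aut_iff antiAut_iff by (simp add: PSL2C_comp_antimoebius)

lemma antiAut_comp_antiAut: "Q \<in> antiAut \<phi> \<Longrightarrow> R \<in> antiAut \<phi> \<Longrightarrow> Q \<circ> R \<in> Aut \<phi>"
  unfolding Aut_iff antiAut_iff by (simp add: antimoebius_comp_antimoebius)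

lemma antiAut_inv:
  assumes "Q \<in> antiAut \<phi>"
  shows "inv_into UNIV Q \<in> antiAut \<phi>"
proof -
  have Q: "Q \<in> antimoebius" "bij Q" "\<And>s. Q (\<phi> s) = \<phi> (Q s)"
    using assms antimoebius_bij unfolding antiAut_iff by blast+
  have "inv_into UNIV Q (\<phi> s) = \<phi> (inv_into UNIV Q s)" for s
    using Q(2) Q(3)[of "inv_into UNIV Q s"] by (metis bij_inv_eq_iff)
  then show ?thesis using antimoebius_inv[OF Q(1)] unfolding antiAut_iff by blast
qed

definition conjugate :: "('a \<Rightarrow> 'a) \<Rightarrow> ('a \<Rightarrow> 'a) \<Rightarrow> 'a \<Rightarrow> 'a" where
  "conjugate S F = S \<circ> F \<circ> inv_into UNIV S"

lemma conjugate_inv: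
  assumes "bij S"
  shows "conjugate (inv_into UNIV S) (conjugate S F) = F" "conjugate S (conjugate (inv_into UNIV S) F) = F"
  using assms unfolding conjugate_def
  by (simp_all add: fun_eq_iff inv_inv_eq bij_is_inj inv_f_f bij_is_surj surj_f_inv_f)

lemma conjugate_comp:
  assumes "bij S"
  shows "conjugate S (F \<circ> G) = conjugate S F \<circ> conjugate S G"
  using assms unfolding conjugate_def by (simp add: fun_eq_iff bij_is_inj inv_f_f)

lemma conjugate_conjugate:
  assumes "bij S" "bij T"
  shows "conjugate T (conjugate S F) = conjugate (T \<circ> S) F"
  using assms unfolding conjugate_def by (simp add: o_inv_distrib comp_assoc)

lemma conjugate_id: "bij S \<Longrightarrow> conjugate S id = id"
  unfolding conjugate_def by (simp add: fun_eq_iff bij_is_surj surj_f_inv_f)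

lemma conjugate_funpow: "bij S \<Longrightarrow> conjugate S (F ^^ k) = conjugate S F ^^ k"
  by (induction k) (simp_all add: conjugate_id conjugate_comp)

lemma conjugate_commute:
  assumes "bij S" "\<forall>s. T (\<phi> s) = \<phi> (T s)"
  shows "\<forall>s. conjugate S T (conjugate S \<phi> s) = conjugate S \<phi> (conjugate S T s)"
  using assms unfolding conjugate_def by (simp add: bij_is_inj inv_f_f)

lemma conjugate_Aut:
  assumes "S \<in> PSL2C" "T \<in> Aut \<phi>"
  shows "conjugate S T \<in> Aut (conjugate S \<phi>)"
  using assms conjugate_commute[OF PSL2C_bij[OF assms(1)]] unfolding Aut_iff
  by (metis PSL2C_comp PSL2C_inv conjugate_def)

lemma conjugate_antiAut:
  assumes "S \<in> PSL2C" "Q \<in> antiAut \<phi>"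
  shows "conjugate S Q \<in> antiAut (conjugate S \<phi>)"
  using assms conjugate_commute[OF PSL2C_bij[OF assms(1)]] unfolding antiAut_iff
  by (metis PSL2C_comp_antimoebius antimoebius_comp_PSL2C PSL2C_inv conjugate_def)

lemma bij_betw_conjugate_Aut:
  assumes "S \<in> PSL2C"
  shows "bij_betw (conjugate S) (Aut \<phi>) (Aut (conjugate S \<phi>))"
proof (rule bij_betw_byWitness[where f' = "conjugate (inv_into UNIV S)"])
  note S = PSL2C_bij[OF assms]
  show "\<forall>T\<in>Aut \<phi>. conjugate (inv_into UNIV S) (conjugate S T) = T"
    "\<forall>T\<in>Aut (conjugate S \<phi>). conjugate S (conjugate (inv_into UNIV S) T) = T"
    using conjugate_inv[OF S] by blast+
  show "conjugate S ` Aut \<phi> \<subseteq> Aut (conjugate S \<phi>)"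
    using conjugate_Aut[OF assms] by blast
  show "conjugate (inv_into UNIV S) ` Aut (conjugate S \<phi>) \<subseteq> Aut \<phi>"
    using conjugate_Aut[OF PSL2C_inv[OF assms], of _ "conjugate S \<phi>"] conjugate_inv(1)[OF S] by auto
qed

lemma conjugate_reflection:
  assumes "S \<in> PSL2C" "is_reflection Q"
  shows "is_reflection (conjugate S Q)"
proof -
  note S = PSL2C_bij[OF assms(1)]
  obtain x where Q: "Q \<in> antimoebius" "Q \<circ> Q = id" "Q x = x"
    using assms(2) unfolding is_reflection_def by blast
  have "conjugate S Q \<in> antimoebius"
    using Q(1) assms(1) unfolding conjugate_def
    by (intro antimoebius_comp_PSL2C PSL2C_comp_antimoebius PSL2C_inv)
  moreover have "conjugate S Q \<circ> conjugate S Q = id"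
    using conjugate_comp[OF S, of Q Q] conjugate_id[OF S] Q(2) by simp
  moreover have "conjugate S Q (S x) = S x"
    using Q(3) S unfolding conjugate_def by (simp add: bij_is_inj inv_f_f)
  ultimately show ?thesis unfolding is_reflection_def by blast
qed

lemma pseudo_real_conjugateI:
  assumes S: "S \<in> PSL2C" and "pseudo_real \<phi>"
  shows "pseudo_real (conjugate S \<phi>)"
  unfolding pseudo_real_def
proof (intro conjI ballI notI)
  show "antiAut (conjugate S \<phi>) = {} \<Longrightarrow> False"
    using assms conjugate_antiAut unfolding pseudo_real_def by blast
next
  fix Q assume Q: "Q \<in> antiAut (conjugate S \<phi>)" "is_reflection Q"
  have "conjugate (inv_into UNIV S) Q \<in> antiAut \<phi>"
    using conjugate_antiAut[OF PSL2C_inv[OF S] Q(1)] conjugate_inv(1)[OF PSL2C_bij[OF S]] by simp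
  moreover have "is_reflection (conjugate (inv_into UNIV S) Q)"
    by (rule conjugate_reflection[OF PSL2C_inv[OF S] Q(2)])
  ultimately show False using assms(2) unfolding pseudo_real_def by blast
qed

lemma pseudo_real_conjugate_iff:
  assumes S: "S \<in> PSL2C"
  shows "pseudo_real (conjugate S \<phi>) \<longleftrightarrow> pseudo_real \<phi>"
  using pseudo_real_conjugateI[OF S, of \<phi>]
    pseudo_real_conjugateI[OF PSL2C_inv[OF S], of "conjugate S \<phi>"]
    conjugate_inv(1)[OF PSL2C_bij[OF S]] by auto


section \<open>Diagonal form of Moebius maps of finite order\<close>

definition scaling :: "complex \<Rightarrow> csphere \<Rightarrow> csphere" where
  "scaling c = moebius c 0 0 1"

lemma scaling_simps [simp]: "scaling c (Pt z) = Pt (c * z)" "scaling c Inf = Inf"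
  by (simp_all add: scaling_def)

lemma scaling_in_PSL2C: "c \<noteq> 0 \<Longrightarrow> scaling c \<in> PSL2C"
  unfolding scaling_def by (rule moebius_in_PSL2C) simp

lemma scaling_comp: "scaling a \<circ> scaling b = scaling (a * b)"
proof
  fix s show "(scaling a \<circ> scaling b) s = scaling (a * b) s" by (cases s) simp_all
qed

lemma scaling_1: "scaling 1 = id"
  unfolding scaling_def by (rule moebius_id) simp

lemma scaling_eq_iff: "scaling a = scaling b \<longleftrightarrow> a = b"
  using scaling_simps(1)[of a 1] scaling_simps(1)[of b 1] by (metis csphere.inject mult.right_neutral)

lemma scaling_funpow: "scaling c ^^ k = scaling (c ^ k)"
  by (induction k) (simp_all add: scaling_1 scaling_comp)

lemma inv_scaling:
  assumes "c \<noteq> 0"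
  shows "inv_into UNIV (scaling c) = scaling (inverse c)"
  using assms by (intro inv_unique_comp) (simp_all add: scaling_comp scaling_1)

lemma scaling_fixed_points:
  assumes "scaling c s = s" "c \<noteq> 1"
  shows "s = Pt 0 \<or> s = Inf"
  using assms by (cases s) auto

text \<open>For \<open>c \<noteq> 0\<close> the fixed points are the roots of \<open>c z\<^sup>2 + (d - a) z - b\<close>, and the quadratic formula
  provides one.\<close>

lemma PSL2C_fixed_point:
  assumes "T \<in> PSL2C"
  obtains s where "T s = s"
proof -
  obtain a b c d where nz: "a * d - b * c \<noteq> 0" and T: "T = moebius a b c d"
    using assms unfolding PSL2C_iff by blast
  show ?thesis
  proof (cases "c = 0")
    case True
    then show ?thesis using that[of Inf] T by simp
  next
    case False
    \<comment> \<open>the square root of the discriminant\<close>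
    define w where "w = csqrt ((a - d)\<^sup>2 + 4 * b * c)"
    define z where "z = (a - d + w) / (2 * c)"
    have w: "w * w = (a - d)\<^sup>2 + 4 * b * c"
      unfolding w_def using power2_csqrt by (metis power2_eq_square)
    have cz: "2 * (c * z) = a - d + w" unfolding z_def using False by simp
    have "4 * c * (z * (c * z + d)) = 4 * c * (a * z + b)"
    proof -
      have "4 * c * (z * (c * z + d)) = (2 * (c * z)) * (2 * (c * z)) + 2 * d * (2 * (c * z))"
        by (simp add: algebra_simps)
      also have "\<dots> = 2 * a * (2 * (c * z)) + 4 * b * c"
        unfolding cz using w by (simp add: algebra_simps power2_eq_square)
      finally show ?thesis by (simp add: algebra_simps)
    qed
    then have eq: "z * (c * z + d) = a * z + b" using False by simp
    have "c * z + d \<noteq> 0"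
    proof
      assume 0: "c * z + d = 0"
      then have "a * z + b = 0" using eq by simp
      with 0 linear_nonzero[OF nz, of z 1] show False by simp
    qed
    then have "T (Pt z) = Pt z" unfolding T using eq by (simp flip: eq)
    then show ?thesis by (rule that)
  qed
qed

lemma PSL2C_to_Inf: obtains S where "S \<in> PSL2C" "S s = Inf"
proof (cases s)
  case (Pt z)
  have "moebius 0 1 1 (- z) \<in> PSL2C" by (rule moebius_in_PSL2C) simp
  then show ?thesis using that Pt by simp
next
  case Inf
  then show ?thesis using that[OF id_in_PSL2C] by simp
qed

lemma PSL2C_fixing_Inf:
  assumes "T \<in> PSL2C" "T Inf = Inf"
  obtains a b where "a \<noteq> 0" "T = moebius a b 0 1"
proof -
  obtain a b c d where nz: "a * d - b * c \<noteq> 0" and T: "T = moebius a b c d"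
    using assms(1) unfolding PSL2C_iff by blast
  have c: "c = 0" using assms(2) T by (simp split: if_splits)
  with nz have "a \<noteq> 0" "d \<noteq> 0" by auto
  moreover have "T = moebius (a / d) (b / d) 0 1"
    using moebius_scale[of "inverse d" a b 0 d] \<open>d \<noteq> 0\<close> unfolding T c by (simp add: field_simps)
  ultimately show ?thesis using that[of "a / d" "b / d"] by simp
qed

lemma translation_funpow: "(moebius 1 b 0 1 ^^ k) (Pt z) = Pt (z + of_nat k * b)"
  by (induction k) (simp_all add: algebra_simps)

text \<open>With one fixed point at infinity the map is \<open>z \<mapsto> a z + b\<close>. For \<open>a = 1\<close> it is a translation,
  which has infinite order unless it is trivial. Otherwise there is a second fixed point
  \<open>b / (1 - a)\<close>, which a translation moves to \<open>0\<close>.\<close>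

lemma finite_order_diagonalizable:
  assumes g: "g \<in> PSL2C" "g \<noteq> id" "g ^^ n = id" and "n > 0"
  obtains S c where "S \<in> PSL2C" "c \<noteq> 0" "conjugate S g = scaling c"
proof -
  obtain s where s: "g s = s" using g(1) by (rule PSL2C_fixed_point)
  obtain S where S: "S \<in> PSL2C" "S s = Inf" by (rule PSL2C_to_Inf)
  note bS = PSL2C_bij[OF S(1)]
  have "conjugate S g \<in> PSL2C"
    using S(1) g(1) unfolding conjugate_def by (intro PSL2C_comp PSL2C_inv)
  moreover have "conjugate S g Inf = Inf"
    unfolding conjugate_def S(2)[symmetric] using s bS by (simp add: bij_is_inj inv_f_f)
  ultimately obtain a b where a: "a \<noteq> 0" and gab: "conjugate S g = moebius a b 0 1"
    by (rule PSL2C_fixing_Inf)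
  have "a \<noteq> 1"
  proof
    assume "a = 1"
    have "conjugate S g ^^ n = id"
      using conjugate_funpow[OF bS, where F = g and k = n] conjugate_id[OF bS] g(3) by simp
    then have "Pt (0 + of_nat n * b) = Pt 0"
      using translation_funpow[where b = b and k = n and z = 0] unfolding gab \<open>a = 1\<close> by simp
    then have "b = 0" using \<open>n > 0\<close> by simp
    then have "conjugate S g = id"
      unfolding gab \<open>a = 1\<close> by (simp add: moebius_id)
    then have "g = id"
      using conjugate_inv(1)[OF bS, of g] conjugate_id[OF bij_imp_bij_inv[OF bS]] by simp
    with g(2) show False ..
  qed
  define e where "e = b / (1 - a)"
  have e: "a * e + b = e"
    unfolding e_def using \<open>a \<noteq> 1\<close> by (simp add: field_simps)
  let ?D = "moebius 1 (- e) 0 1"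
  have D: "?D \<in> PSL2C" by (rule moebius_in_PSL2C) simp
  have "conjugate ?D (moebius a b 0 1) = scaling a"
  proof
    fix u
    have "inv_into UNIV ?D = moebius 1 e 0 1"
      using inv_moebius[of 1 1 "- e" 0] by simp
    moreover have "a * (z + e) + b - e = a * z" for z
      using e by (simp add: algebra_simps)
    ultimately show "conjugate ?D (moebius a b 0 1) u = scaling a u"
      by (cases u) (simp_all add: conjugate_def)
  qed
  then have "conjugate (?D \<circ> S) g = scaling a"
    using conjugate_conjugate[OF bS PSL2C_bij[OF D], of g] unfolding gab by simp
  then show ?thesis using that PSL2C_comp[OF D S(1)] a by blast
qed


section \<open>Anti-Moebius maps preserving \<open>{Pt 0, Inf}\<close>\<close>

text \<open>For \<open>c > 0\<close> this is the inversion in the circle of radius \<open>sqrt c\<close> around \<open>0\<close>.\<close>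

definition antiinversion :: "complex \<Rightarrow> csphere \<Rightarrow> csphere" where
  "antiinversion c = moebius 0 c 1 0 \<circ> sphere_cnj"

lemma antiinversion_simps [simp]:
  "antiinversion c (Pt z) = (if z = 0 then Inf else Pt (c / cnj z))"
  "antiinversion c Inf = Pt 0"
  by (simp_all add: antiinversion_def)

lemma antiinversion_in_antimoebius: "c \<noteq> 0 \<Longrightarrow> antiinversion c \<in> antimoebius"
  unfolding antimoebius_def antiinversion_def using moebius_in_PSL2C[of 0 0 c 1] by auto

lemma antimoebius_fixing_0_Inf:
  assumes "Q \<in> antimoebius" "Q (Pt 0) = Pt 0" "Q Inf = Inf"
  obtains c where "c \<noteq> 0" "Q = scaling c \<circ> sphere_cnj"
proof -
  obtain T where T: "T \<in> PSL2C" "Q = T \<circ> sphere_cnj"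
    using assms(1) unfolding antimoebius_def by blast
  have "T Inf = Inf" using assms(3) T(2) by simp
  with T(1) obtain a b where ab: "a \<noteq> 0" "T = moebius a b 0 1"
    by (rule PSL2C_fixing_Inf)
  have "b = 0" using assms(2) T(2) ab(2) by simp
  then show ?thesis using that[OF ab(1)] T(2) ab(2) unfolding scaling_def by simp
qed

lemma antimoebius_swapping_0_Inf:
  assumes "Q \<in> antimoebius" "Q (Pt 0) = Inf" "Q Inf = Pt 0"
  obtains c where "c \<noteq> 0" "Q = antiinversion c"
proof -
  obtain T where T: "T \<in> PSL2C" "Q = T \<circ> sphere_cnj"
    using assms(1) unfolding antimoebius_def by blast
  then obtain a b c d where nz: "a * d - b * c \<noteq> 0" and Tm: "T = moebius a b c d"
    unfolding PSL2C_iff by blast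
  have "d = 0" "a = 0" using assms(2,3) T(2) Tm by (simp_all split: if_splits)
  with nz have "b \<noteq> 0" "c \<noteq> 0" by auto
  moreover have "T = moebius 0 (b / c) 1 0"
    using moebius_scale[of "inverse c" 0 b c 0] \<open>c \<noteq> 0\<close> unfolding Tm \<open>d = 0\<close> \<open>a = 0\<close>
    by (simp add: field_simps)
  ultimately show ?thesis using that[of "b / c"] T(2) unfolding antiinversion_def by simp
qed

text \<open>The conjugate of the rotation \<open>scaling c\<close> by \<open>Q\<close> is again an automorphism, so it fixes \<open>0\<close> and
  \<open>\<infinity>\<close>. Equivalently \<open>scaling c\<close> fixes their images under \<open>Q\<close>, but its only fixed points are \<open>0\<close>
  and \<open>\<infinity>\<close>.\<close>

lemma antiAut_permutes_0_Inf:
  assumes "scaling c \<in> Aut \<phi>" "c \<noteq> 1"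
    and fixes_0_Inf: "\<And>T. T \<in> Aut \<phi> \<Longrightarrow> T (Pt 0) = Pt 0 \<and> T Inf = Inf"
    and Q: "Q \<in> antiAut \<phi>"
  shows "Q (Pt 0) = Pt 0 \<and> Q Inf = Inf \<or> Q (Pt 0) = Inf \<and> Q Inf = Pt 0"
proof -
  have bij: "bij Q" using Q antimoebius_bij unfolding antiAut_iff by blast
  have "inv_into UNIV Q \<circ> (scaling c \<circ> Q) \<in> Aut \<phi>"
    by (intro antiAut_comp_antiAut antiAut_inv Aut_comp_antiAut assms)
  from fixes_0_Inf[OF this] have "scaling c (Q (Pt 0)) = Q (Pt 0)" "scaling c (Q Inf) = Q Inf"
    unfolding comp_apply using bij by (metis bij_inv_eq_iff)+
  then have "Q (Pt 0) \<in> {Pt 0, Inf}" "Q Inf \<in> {Pt 0, Inf}"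
    using scaling_fixed_points assms(2) by blast+
  moreover have "Q (Pt 0) \<noteq> Q Inf"
    using bij by (simp add: bij_is_inj inj_eq)
  ultimately show ?thesis by auto
qed


section \<open>Cyclic automorphism groups\<close>

text \<open>The abstract isomorphism is used only through a generator \<open>g\<close>, the preimage of \<open>1\<close>, and its
  exact order.\<close>

lemma Aut_group_cyclic:
  assumes "Aut_group \<phi> \<cong> integer_mod_group n" "n > 0"
  obtains g where "g \<in> Aut \<phi>" "\<And>k. g ^^ k = id \<longleftrightarrow> n dvd k" "\<And>T. T \<in> Aut \<phi> \<Longrightarrow> \<exists>k. T = g ^^ k"
proof -
  obtain f where "f \<in> iso (Aut_group \<phi>) (integer_mod_group n)"
    using assms(1) unfolding is_iso_def by blast
  then have bij: "bij_betw f (Aut \<phi>) {0..<int n}"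
    and hom: "\<And>S T. S \<in> Aut \<phi> \<Longrightarrow> T \<in> Aut \<phi> \<Longrightarrow> f (S \<circ> T) = (f S + f T) mod int n"
    using assms(2)
    by (auto simp: iso_def hom_def Aut_group_def carrier_integer_mod_group mult_integer_mod_group)
  have id: "id \<in> Aut \<phi>" unfolding Aut_iff using id_in_PSL2C by simp
  have f0: "f id = 0"
  proof -
    have "f id \<in> {0..<int n}" using bij id bij_betwE by blast
    moreover have "(f id + f id) mod int n = f id mod int n"
      using hom[OF id id] calculation by simp
    then have "int n dvd f id" by (simp add: mod_eq_dvd_iff)
    ultimately show ?thesis using zdvd_not_zless[of "f id" "int n"] by fastforce
  qed
  \<comment> \<open>Written as \<open>1 mod int n\<close>, the generator also makes sense in the trivial group \<open>n = 1\<close>.\<close>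
  have "1 mod int n \<in> {0..<int n}" using assms(2) by simp
  then obtain g where g: "g \<in> Aut \<phi>" "f g = 1 mod int n"
    using bij by (metis bij_betw_imp_surj_on imageE)
  have pow: "g ^^ k \<in> Aut \<phi> \<and> f (g ^^ k) = int k mod int n" for k
  proof (induction k)
    case 0
    then show ?case using id f0 by (simp add: id_def)
  next
    case (Suc k)
    have "g \<circ> g ^^ k \<in> Aut \<phi>"
      using g(1) Suc unfolding Aut_iff by (auto intro: PSL2C_comp)
    moreover have "f (g \<circ> g ^^ k) = int (Suc k) mod int n"
      using hom[OF g(1), of "g ^^ k"] Suc g(2) by (simp add: mod_add_eq)
    ultimately show ?case unfolding funpow.simps by blast
  qed
  have inj: "S = T" if "S \<in> Aut \<phi>" "T \<in> Aut \<phi>" "f S = f T" for S T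
    using bij that unfolding bij_betw_def inj_on_def by blast
  show ?thesis
  proof
    show "g \<in> Aut \<phi>" by (rule g(1))
    show "g ^^ k = id \<longleftrightarrow> n dvd k" for k
    proof -
      have "g ^^ k = id \<longleftrightarrow> f (g ^^ k) = f id"
        using inj[OF _ id, of "g ^^ k"] pow[of k] by auto
      also have "\<dots> \<longleftrightarrow> int k mod int n = 0"
        using pow[of k] f0 by simp
      also have "\<dots> \<longleftrightarrow> n dvd k"
        by (simp add: dvd_eq_mod_eq_0 flip: zmod_int)
      finally show ?thesis .
    qed
    show "\<exists>k. T = g ^^ k" if T: "T \<in> Aut \<phi>" for T
    proof
      have "f T \<in> {0..<int n}" using bij T bij_betwE by blast
      then have "f (g ^^ nat (f T)) = f T" using pow[of "nat (f T)"] by simp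
      then show "T = g ^^ nat (f T)" using inj[OF T, of "g ^^ nat (f T)"] pow[of "nat (f T)"] by simp
    qed
  qed
qed


section \<open>Maps commuting with a rotation group\<close>

abbreviation equivariant :: "ratfun \<Rightarrow> nat \<Rightarrow> ratfun" where
  "equivariant \<psi> n \<equiv> rat_var * rat_comp \<psi> (rat_var ^ n)"

lemma rat_val_equivariant:
  "\<forall>\<^sub>F z in cofinite. rat_val (equivariant \<psi> n) z = z * rat_val \<psi> (z ^ n)"
  using rat_val_mult[of rat_var "rat_comp \<psi> (rat_var ^ n)"] rat_val_to_fract[of "[:0, 1:]"]
    rat_val_comp[of \<psi> "rat_var ^ n"] rat_val_rat_var_power[of n]
  by eventually_elim simp

lemma rat_map_equivariant:
  "\<forall>\<^sub>F z in cofinite. rat_map (equivariant \<psi> n) (Pt z) = Pt (z * rat_val \<psi> (z ^ n))"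
  using rat_map_eq_rat_val[of "equivariant \<psi> n"] rat_val_equivariant[of \<psi> n]
  by eventually_elim simp

lemma rat_map_cnj_equivariant:
  "\<forall>\<^sub>F z in cofinite. rat_map (rat_cnj (equivariant \<psi> n)) (Pt z)
     = Pt (z * rat_val (rat_cnj \<psi>) (z ^ n))"
proof -
  have "inj cnj" by (simp add: inj_def)
  then have "\<forall>\<^sub>F z in cofinite. rat_val (equivariant \<psi> n) (cnj z) = cnj z * rat_val \<psi> (cnj z ^ n)"
    using rat_val_equivariant[of \<psi> n] filterlim_cofinite_inj
    unfolding filterlim_iff by blast
  then show ?thesis
    using rat_map_eq_rat_val[of "rat_cnj (equivariant \<psi> n)"]
    by eventually_elim (simp add: rat_val_rat_cnj)
qed

lemma eventually_cofinite_mult: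
  fixes c :: complex
  assumes "c \<noteq> 0" "\<forall>\<^sub>F z in cofinite. P z"
  shows "\<forall>\<^sub>F z in cofinite. P (c * z)"
proof -
  have "inj (\<lambda>z. c * z)" using assms(1) by (simp add: inj_def)
  from filterlim_cofinite_inj[OF this] show ?thesis
    using assms(2) unfolding filterlim_iff by blast
qed

lemma eventually_cofinite_divide:
  fixes c :: complex
  assumes "c \<noteq> 0" "\<forall>\<^sub>F z in cofinite. P z"
  shows "\<forall>\<^sub>F z in cofinite. P (c / z)"
proof -
  have "inj (\<lambda>z. c / z)" using assms(1) by (simp add: inj_def divide_inverse)
  from filterlim_cofinite_inj[OF this] show ?thesis
    using assms(2) unfolding filterlim_iff by blast
qed

lemma eventually_cofinite_power_iff:
  fixes P :: "complex \<Rightarrow> bool"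
  assumes "n > 0"
  shows "(\<forall>\<^sub>F z in cofinite. P (z ^ n)) \<longleftrightarrow> (\<forall>\<^sub>F z in cofinite. P z)"
proof
  show "\<forall>\<^sub>F z in cofinite. P (z ^ n) \<Longrightarrow> \<forall>\<^sub>F z in cofinite. P z"
    by (rule eventually_cofinite_surjD[OF surj_power[OF assms]])
  show "\<forall>\<^sub>F z in cofinite. P z \<Longrightarrow> \<forall>\<^sub>F z in cofinite. P (z ^ n)"
    using filterlim_cofinite_power[OF assms] unfolding filterlim_iff by (elim allE impE)
qed

lemma rotation_in_Aut:
  assumes "n > 0" "w ^ n = 1"
  shows "scaling w \<in> Aut (rat_map (equivariant \<psi> n))"
proof -
  let ?F = "rat_map (equivariant \<psi> n)"
  have w: "w \<noteq> 0" using assms by (metis power_0_left zero_neq_one less_irrefl)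
  have "scaling w \<circ> ?F = ?F \<circ> scaling w"
  proof (rule rational_eqI)
    show "rational (scaling w \<circ> ?F)" "rational (?F \<circ> scaling w)"
      using rational_rat_map scaling_in_PSL2C[OF w]
      by (simp_all add: rational_PSL2C_comp rational_comp_PSL2C)
    show "\<forall>\<^sub>F z in cofinite. (scaling w \<circ> ?F) (Pt z) = (?F \<circ> scaling w) (Pt z)"
      using rat_map_equivariant[of \<psi> n] eventually_cofinite_mult[OF w rat_map_equivariant[of \<psi> n]]
      by eventually_elim (simp add: power_mult_distrib assms(2))
  qed
  then show ?thesis
    using scaling_in_PSL2C[OF w] unfolding Aut_iff by (metis comp_apply)
qed

text \<open>Write \<open>antiinversion \<alpha> = T \<circ> sphere_cnj\<close> with the involution \<open>T z = \<alpha> / z\<close>. Commuting with the map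
  \<open>F z = z \<psi>(z ^ n)\<close> means \<open>T \<circ> C \<circ> T = F\<close>, where \<open>C\<close> is the conjugate of \<open>F\<close>. At \<open>z\<close> the left side
  is \<open>z / Y\<close> and the right side \<open>z X\<close>, with \<open>X = \<psi>(z ^ n)\<close> and \<open>Y\<close> the value of the conjugate of \<open>\<psi>\<close>
  at \<open>\<alpha> ^ n / z ^ n\<close>; so the condition is \<open>X Y = 1\<close>. Since \<open>z ^ n\<close> takes every value, \<open>z ^ n\<close> can be
  replaced by a free variable.\<close>

lemma antiinversion_in_antiAut_iff:
  assumes "n > 0" "\<alpha> \<noteq> 0"
  shows "antiinversion \<alpha> \<in> antiAut (rat_map (equivariant \<psi> n)) \<longleftrightarrow>
    \<psi> * rat_comp (rat_cnj \<psi>) (rat_const (\<alpha> ^ n) / rat_var) = 1"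
proof -
  let ?F = "rat_map (equivariant \<psi> n)" and ?T = "moebius 0 \<alpha> 1 0"
    and ?C = "rat_map (rat_cnj (equivariant \<psi> n))"
  define Y where "Y u = rat_val (rat_cnj \<psi>) (\<alpha> ^ n / u)" for u
  have T: "?T \<in> PSL2C" using assms by (intro moebius_in_PSL2C) simp
  have TT: "?T (?T s) = s" for s
    using assms by (cases s) auto
  have "antiinversion \<alpha> \<in> antiAut ?F \<longleftrightarrow> (\<forall>s. antiinversion \<alpha> (?F s) = ?F (antiinversion \<alpha> s))"
    using antiinversion_in_antimoebius[OF assms(2)] unfolding antiAut_iff by blast
  also have "\<dots> \<longleftrightarrow> ?T \<circ> ?C \<circ> ?T = ?F"
  proof
    assume *: "\<forall>s. antiinversion \<alpha> (?F s) = ?F (antiinversion \<alpha> s)"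
    show "?T \<circ> ?C \<circ> ?T = ?F"
    proof
      fix s
      show "(?T \<circ> ?C \<circ> ?T) s = ?F s"
        using spec[OF *, of "sphere_cnj (?T s)"]
        unfolding antiinversion_def rat_map_rat_cnj by (simp add: sphere_cnj_involution TT)
    qed
  next
    assume *: "?T \<circ> ?C \<circ> ?T = ?F"
    show "\<forall>s. antiinversion \<alpha> (?F s) = ?F (antiinversion \<alpha> s)"
    proof
      fix s
      show "antiinversion \<alpha> (?F s) = ?F (antiinversion \<alpha> s)"
        using fun_cong[OF *, of "?T (sphere_cnj s)"]
        unfolding antiinversion_def rat_map_rat_cnj by (simp add: sphere_cnj_involution TT)
    qed
  qed
  also have "\<dots> \<longleftrightarrow> (\<forall>\<^sub>F z in cofinite. (?T \<circ> ?C \<circ> ?T) (Pt z) = ?F (Pt z))"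
  proof
    assume "?T \<circ> ?C \<circ> ?T = ?F"
    then show "\<forall>\<^sub>F z in cofinite. (?T \<circ> ?C \<circ> ?T) (Pt z) = ?F (Pt z)"
      by (simp only: simp_thms eventually_True)
  next
    assume "\<forall>\<^sub>F z in cofinite. (?T \<circ> ?C \<circ> ?T) (Pt z) = ?F (Pt z)"
    then show "?T \<circ> ?C \<circ> ?T = ?F"
      by (intro rational_eqI[of "?T \<circ> ?C \<circ> ?T" ?F] rational_comp_PSL2C rational_PSL2C_comp
          rational_rat_map T)
  qed
  also have "\<dots> \<longleftrightarrow> (\<forall>\<^sub>F z in cofinite. rat_val \<psi> (z ^ n) * Y (z ^ n) = 1)"
  proof (rule eventually_subst)
    have "\<forall>\<^sub>F z in cofinite. ?C (Pt (\<alpha> / z)) = Pt (\<alpha> / z * Y (z ^ n))"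
      using eventually_cofinite_divide[OF assms(2) rat_map_cnj_equivariant[of \<psi> n]]
      by eventually_elim (simp add: Y_def power_divide)
    moreover have "\<forall>\<^sub>F z in cofinite. z \<noteq> (0 :: complex)"
      by (simp add: eventually_cofinite)
    ultimately show "\<forall>\<^sub>F z in cofinite. ((?T \<circ> ?C \<circ> ?T) (Pt z) = ?F (Pt z)) =
        (rat_val \<psi> (z ^ n) * Y (z ^ n) = 1)"
      using rat_map_equivariant[of \<psi> n]
    proof eventually_elim
      case (elim z)
      have "(?T \<circ> ?C \<circ> ?T) (Pt z) = ?T (Pt (\<alpha> / z * Y (z ^ n)))"
        using elim(1,2) by simp
      also have "\<dots> = (if Y (z ^ n) = 0 then Inf else Pt (z / Y (z ^ n)))"
        using assms(2) elim(2) by simp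
      finally show ?case
        using elim(2,3) by (simp add: divide_eq_eq)
    qed
  qed
  also have "\<dots> \<longleftrightarrow> (\<forall>\<^sub>F u in cofinite. rat_val \<psi> u * Y u = 1)"
    by (rule eventually_cofinite_power_iff[OF assms(1)])
  also have "\<dots> \<longleftrightarrow> (\<forall>\<^sub>F u in cofinite.
      rat_val (\<psi> * rat_comp (rat_cnj \<psi>) (rat_const (\<alpha> ^ n) / rat_var)) u = rat_val 1 u)"
  proof (rule eventually_subst)
    show "\<forall>\<^sub>F u in cofinite. (rat_val \<psi> u * Y u = 1) =
      (rat_val (\<psi> * rat_comp (rat_cnj \<psi>) (rat_const (\<alpha> ^ n) / rat_var)) u = rat_val 1 u)"
      using rat_val_mult[of \<psi> "rat_comp (rat_cnj \<psi>) (rat_const (\<alpha> ^ n) / rat_var)"]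
        rat_val_comp[of "rat_cnj \<psi>" "rat_const (\<alpha> ^ n) / rat_var"]
        rat_val_divide[of "rat_const (\<alpha> ^ n)" rat_var]
        rat_val_to_fract[of "[:\<alpha> ^ n:]"] rat_val_to_fract[of "[:0, 1:]"] rat_val_to_fract[of 1]
      by eventually_elim (simp add: Y_def)
  qed
  also have "\<dots> \<longleftrightarrow> \<psi> * rat_comp (rat_cnj \<psi>) (rat_const (\<alpha> ^ n) / rat_var) = 1"
    by (auto intro: rat_val_eqI)
  finally show ?thesis .
qed

text \<open>The symmetry of \<open>\<psi>\<close> is evaluated at \<open>\<mu> ^ n * u\<close>, where the factor \<open>cnj \<mu> ^ n\<close> cancels because
  \<open>\<bar>\<mu>\<bar> = 1\<close>.\<close>

lemma scaled_cnj_in_antiAut: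
  assumes "n > 0" "cmod \<mu> = 1"
    and "\<psi> = rat_comp (rat_cnj \<psi>) (rat_const (cnj \<mu> ^ n) * rat_var)"
  shows "scaling \<mu> \<circ> sphere_cnj \<in> antiAut (rat_map (equivariant \<psi> n))"
proof -
  let ?F = "rat_map (equivariant \<psi> n)" and ?C = "rat_map (rat_cnj (equivariant \<psi> n))"
  have \<mu>: "\<mu> \<noteq> 0" using assms(2) by auto
  have unit: "cnj \<mu> ^ n * \<mu> ^ n = 1"
    using assms(2) complex_norm_square[of \<mu>] by (simp add: mult.commute flip: power_mult_distrib)
  have "\<forall>\<^sub>F u in cofinite. rat_val \<psi> u = rat_val (rat_cnj \<psi>) (cnj \<mu> ^ n * u)"
    using rat_val_comp[of "rat_cnj \<psi>" "rat_const (cnj \<mu> ^ n) * rat_var"]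
      rat_val_mult[of "rat_const (cnj \<mu> ^ n)" rat_var]
      rat_val_to_fract[of "[:cnj \<mu> ^ n:]"] rat_val_to_fract[of "[:0, 1:]"]
    unfolding assms(3)[symmetric] by eventually_elim (simp add: mult.commute)
  from eventually_cofinite_mult[OF _ this, of "\<mu> ^ n"]
  have "\<forall>\<^sub>F u in cofinite. rat_val \<psi> (\<mu> ^ n * u) = rat_val (rat_cnj \<psi>) u"
    using \<mu> unit by (simp flip: mult.assoc)
  then have inv: "\<forall>\<^sub>F z in cofinite. rat_val \<psi> (\<mu> ^ n * z ^ n) = rat_val (rat_cnj \<psi>) (z ^ n)"
    by (rule eventually_cofinite_power_iff[OF assms(1), THEN iffD2])
  have "scaling \<mu> \<circ> ?C = ?F \<circ> scaling \<mu>"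
  proof (rule rational_eqI)
    show "rational (scaling \<mu> \<circ> ?C)" "rational (?F \<circ> scaling \<mu>)"
      using rational_rat_map scaling_in_PSL2C[OF \<mu>]
      by (simp_all add: rational_PSL2C_comp rational_comp_PSL2C)
    show "\<forall>\<^sub>F z in cofinite. (scaling \<mu> \<circ> ?C) (Pt z) = (?F \<circ> scaling \<mu>) (Pt z)"
      using rat_map_cnj_equivariant[of \<psi> n] inv
        eventually_cofinite_mult[OF \<mu> rat_map_equivariant[of \<psi> n]]
      by eventually_elim (simp add: power_mult_distrib)
  qed
  note pointwise = fun_cong[OF this]
  have "(scaling \<mu> \<circ> sphere_cnj) (?F s) = ?F ((scaling \<mu> \<circ> sphere_cnj) s)" for s
    using pointwise[of "sphere_cnj s"] unfolding rat_map_rat_cnj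
    by (simp add: sphere_cnj_involution)
  moreover have "scaling \<mu> \<circ> sphere_cnj \<in> antimoebius"
    unfolding antimoebius_def using scaling_in_PSL2C[OF \<mu>] by blast
  ultimately show ?thesis unfolding antiAut_iff by blast
qed

lemma scaled_cnj_reflection:
  assumes "cmod \<mu> = 1"
  shows "is_reflection (scaling \<mu> \<circ> sphere_cnj)"
  unfolding is_reflection_def
proof (intro conjI exI)
  have "\<mu> \<noteq> 0" using assms by auto
  then show "scaling \<mu> \<circ> sphere_cnj \<in> antimoebius"
    unfolding antimoebius_def using scaling_in_PSL2C by blast
  have "\<mu> * cnj \<mu> = 1" using assms complex_norm_square[of \<mu>] by simp
  then have "\<mu> * (cnj \<mu> * z) = z" for z by (simp flip: mult.assoc)
  then show "(scaling \<mu> \<circ> sphere_cnj) \<circ> (scaling \<mu> \<circ> sphere_cnj) = id"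
  proof -
    have "((scaling \<mu> \<circ> sphere_cnj) \<circ> (scaling \<mu> \<circ> sphere_cnj)) s = id s" for s
      using \<open>\<And>z. \<mu> * (cnj \<mu> * z) = z\<close> by (cases s) simp_all
    then show ?thesis ..
  qed
  show "(scaling \<mu> \<circ> sphere_cnj) (Pt 0) = Pt 0" by simp
qed

text \<open>Comparing coefficients, only the exponents divisible by \<open>n\<close> survive.\<close>

lemma poly_invariant_under_primitive_root:
  assumes "\<And>k. c ^ k = 1 \<longleftrightarrow> n dvd k" and "pcompose p [:0, c:] = p"
  obtains P where "\<And>z :: complex. poly p z = poly P (z ^ n)"
proof
  let ?P = "\<Sum>k\<le>degree p. monom (coeff p k) (k div n)"
  fix z :: complex
  have "coeff p k = 0 \<or> n dvd k" for k
  proof -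
    have "coeff p k * c ^ k = coeff p k"
      using arg_cong[OF assms(2), of "\<lambda>q. coeff q k"] by (simp add: coeff_pcompose_linear)
    then show ?thesis using assms(1)[of k] by auto
  qed
  then have "coeff p k * (z ^ n) ^ (k div n) = coeff p k * z ^ k" for k
    by (metis dvd_mult_div_cancel mult_zero_left power_mult)
  then have "poly p z = (\<Sum>k\<le>degree p. coeff p k * (z ^ n) ^ (k div n))"
    unfolding poly_altdef[of p] by (simp only:)
  then show "poly p z = poly ?P (z ^ n)"
    by (simp add: poly_sum poly_monom)
qed

text \<open>The function \<open>h = f / z\<close> is invariant under \<open>z \<mapsto> c z\<close>. In lowest terms \<open>a / b\<close> this
  substitution multiplies \<open>a\<close> and \<open>b\<close> by the same constant \<open>e\<close>, since lowest terms are unique up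
  to constants. As \<open>a\<close> and \<open>b\<close> do not both vanish at \<open>0\<close>, where the substitution has no effect,
  \<open>e = 1\<close>, and both are polynomials in \<open>z ^ n\<close>.\<close>

lemma equivariant_form:
  assumes "n > 0" "\<And>k. c ^ k = 1 \<longleftrightarrow> n dvd k" and "scaling c \<in> Aut (rat_map f)"
  obtains \<psi> where "f = equivariant \<psi> n"
proof -
  let ?h = "f / rat_var"
  have c: "c ^ n = 1" using assms(2) by simp
  then have c0: "c \<noteq> 0" using assms(1) by (metis power_0_left zero_neq_one less_irrefl)
  obtain a b where ab: "quot_of_fract ?h = (a, b)" by fastforce
  have b: "b \<noteq> 0" and cop: "coprime a b" and h: "?h = Fract a b"
    using snd_quot_of_fract_nonzero[of ?h] coprime_quot_of_fract[of ?h]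
      Fract_quot_of_fract[of ?h] ab by simp_all
  let ?L = "\<lambda>p. pcompose p [:0, c:]"
  have h_val: "\<forall>\<^sub>F z in cofinite. rat_val ?h z = rat_val f z / z"
    using rat_val_divide[of f rat_var] rat_val_to_fract[of "[:0, 1:]"] by eventually_elim simp
  have comm: "rat_map f (Pt (c * z)) = scaling c (rat_map f (Pt z))" for z
    using assms(3) unfolding Aut_iff by (metis scaling_simps(1))
  have "\<forall>\<^sub>F z in cofinite. rat_val f (c * z) = c * rat_val f z"
    using rat_map_eq_rat_val[of f] eventually_cofinite_mult[OF c0 rat_map_eq_rat_val[of f]]
  proof eventually_elim
    case (elim z)
    then show ?case using comm[of z] by simp
  qed
  then have "\<forall>\<^sub>F z in cofinite. rat_val ?h (c * z) = rat_val ?h z"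
    using h_val eventually_cofinite_mult[OF c0 h_val]
    by eventually_elim (simp add: c0)
  then have "\<forall>\<^sub>F z in cofinite. poly (?L a * b) z = poly (a * ?L b) z"
    using eventually_poly_nonzero[OF b] eventually_cofinite_mult[OF c0 eventually_poly_nonzero[OF b]]
    by eventually_elim (simp add: rat_val_def ab poly_pcompose frac_eq_eq mult.commute)
  then have eq: "?L a * b = a * ?L b" by (rule poly_eqI_cofinite)
  have deg: "degree (?L b) = degree b" by (simp add: degree_pcompose c0)
  then have Lb: "?L b \<noteq> 0" using b c0 using pcompose_eq_0[of b "[:0, c:]"] by auto
  have "b dvd a * ?L b" unfolding eq[symmetric] by simp
  then have "b dvd ?L b"
    using cop by (simp add: coprime_commute coprime_dvd_mult_right_iff)
  then obtain k where k: "?L b = b * k" by (elim dvdE)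
  then have "k \<noteq> 0" using Lb by auto
  then have "degree k = 0" using deg k b by (simp add: degree_mult_eq)
  then obtain e where e: "k = [:e:]" by (rule degree_eq_zeroE)
  then have Lb_e: "?L b = smult e b" using k by simp
  then have "?L a * b = smult e a * b" using eq by simp
  then have La_e: "?L a = smult e a" using b mult_right_cancel by blast
  have "e = 1"
  proof -
    have "poly a 0 \<noteq> 0 \<or> poly b 0 \<noteq> 0"
    proof (rule ccontr)
      assume "\<not> ?thesis"
      then have "[:- 0, 1:] dvd a" "[:- 0, 1:] dvd b" by (simp_all only: poly_eq_0_iff_dvd de_Morgan_disj not_not)
      then have "is_unit [:- 0, 1 :: complex:]" using cop coprime_common_divisor by blast
      then show False by (simp add: is_unit_iff_degree)
    qed
    then show ?thesis
      using arg_cong[OF Lb_e, of "\<lambda>q. poly q 0"] arg_cong[OF La_e, of "\<lambda>q. poly q 0"]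
      by (auto simp: poly_pcompose)
  qed
  obtain A where A: "\<And>z. poly a z = poly A (z ^ n)"
    using poly_invariant_under_primitive_root[OF assms(2)] La_e \<open>e = 1\<close> by (metis smult_1_left)
  obtain B where B: "\<And>z. poly b z = poly B (z ^ n)"
    using poly_invariant_under_primitive_root[OF assms(2)] Lb_e \<open>e = 1\<close> by (metis smult_1_left)
  have "B \<noteq> 0" using B b by (metis poly_0 poly_all_0_iff_0)
  have "f = equivariant (Fract A B) n"
  proof (rule rat_val_eqI)
    have "\<forall>\<^sub>F z in cofinite. rat_val (Fract A B) (z ^ n) = poly A (z ^ n) / poly B (z ^ n)"
      by (rule eventually_cofinite_power_iff[OF assms(1), THEN iffD2, OF rat_val_Fract[OF \<open>B \<noteq> 0\<close>]])
    moreover have "\<forall>\<^sub>F z in cofinite. z \<noteq> (0 :: complex)"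
      by (simp add: eventually_cofinite)
    ultimately show "\<forall>\<^sub>F z in cofinite. rat_val f z = rat_val (equivariant (Fract A B) n) z"
      using h_val rat_val_equivariant[of "Fract A B" n]
    proof eventually_elim
      case (elim z)
      have "rat_val ?h z = poly A (z ^ n) / poly B (z ^ n)"
        by (simp add: rat_val_def ab A B)
      then show ?case using elim by (simp add: field_simps)
    qed
  qed
  then show ?thesis by (rule that)
qed

lemma conjugate_rational: "rational F \<Longrightarrow> S \<in> PSL2C \<Longrightarrow> rational (conjugate S F)"
  unfolding conjugate_def by (intro rational_PSL2C_comp rational_comp_PSL2C PSL2C_inv)

text \<open>The \<open>n\<close> rotations exhaust the automorphism group by cardinality. If \<open>R\<close> is an antiholomorphic
  automorphism, then \<open>R \<circ> antiinversion \<alpha>\<close> is a rotation by some \<open>w\<close>; at the preimage \<open>y\<close> of a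
  fixed point of \<open>R\<close> this reads \<open>\<alpha> / cnj y = w y\<close>, so \<open>\<alpha> = w \<bar>y\<bar>\<^sup>2\<close>, and taking moduli
  \<open>\<alpha> = w\<close>.\<close>

lemma pseudo_real_equivariant:
  assumes "n > 0" "card (Aut (rat_map (equivariant \<psi> n))) = n"
    and "cmod \<alpha> = 1" "\<alpha> ^ n \<noteq> 1"
    and "antiinversion \<alpha> \<in> antiAut (rat_map (equivariant \<psi> n))"
  shows "pseudo_real (rat_map (equivariant \<psi> n))"
  unfolding pseudo_real_def
proof (intro conjI ballI notI)
  let ?F = "rat_map (equivariant \<psi> n)"
  show "antiAut ?F = {} \<Longrightarrow> False" using assms(5) by blast
  have "scaling ` {w. w ^ n = 1} = Aut ?F"
  proof (rule card_subset_eq)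
    show "finite (Aut ?F)" using assms(1,2) by (metis card.infinite less_irrefl)
    show "scaling ` {w. w ^ n = 1} \<subseteq> Aut ?F" using rotation_in_Aut[OF assms(1)] by blast
    have "inj scaling" by (simp add: inj_def scaling_eq_iff)
    then show "card (scaling ` {w. w ^ n = 1}) = card (Aut ?F)"
      using card_nth_roots[of 1 n] assms(1,2) by (simp add: card_image inj_on_subset)
  qed
  then have Aut: "\<exists>w. w ^ n = 1 \<and> T = scaling w" if "T \<in> Aut ?F" for T
    using that by blast
  fix R assume R: "R \<in> antiAut ?F" "is_reflection R"
  obtain x where x: "R x = x" using R(2) unfolding is_reflection_def by blast
  obtain w where w: "w ^ n = 1" "R \<circ> antiinversion \<alpha> = scaling w"
    using Aut[OF antiAut_comp_antiAut[OF R(1) assms(5)]] by blast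
  have "bij (antiinversion \<alpha>)" using assms(5) antimoebius_bij unfolding antiAut_iff by blast
  then obtain y where y: "x = antiinversion \<alpha> y" by (metis bij_pointE)
  have fixed: "antiinversion \<alpha> y = scaling w y"
    using x fun_cong[OF w(2), of y] unfolding y by simp
  have "cmod w = 1"
    using w(1) assms(1) by (metis norm_one norm_power power_eq_1_iff norm_ge_zero less_irrefl)
  show False
  proof (cases y)
    case Inf
    then show False using fixed by simp
  next
    case (Pt z)
    have z: "z \<noteq> 0" and wz: "\<alpha> / cnj z = w * z"
      using fixed Pt by (simp_all split: if_splits)
    then have eq: "\<alpha> = w * (z * cnj z)" by (simp add: field_simps)
    have "cmod \<alpha> = cmod w * (cmod z)\<^sup>2" unfolding eq by (simp add: norm_mult power2_eq_square)
    then have "(cmod z)\<^sup>2 = 1" using assms(3) \<open>cmod w = 1\<close> by simp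
    then have "z * cnj z = 1" using complex_norm_square[of z] by (simp flip: of_real_power)
    then have "\<alpha> = w" using eq by simp
    then show False using w(1) assms(4) by simp
  qed
qed

lemma conjugate_scaling_antiinversion:
  assumes "r \<noteq> 0"
  shows "conjugate (scaling (complex_of_real r)) (antiinversion \<beta>) = antiinversion (complex_of_real (r\<^sup>2) * \<beta>)"
proof
  fix s
  show "conjugate (scaling (complex_of_real r)) (antiinversion \<beta>) s = antiinversion (complex_of_real (r\<^sup>2) * \<beta>) s"
    using assms unfolding conjugate_def
    by (cases s) (simp_all add: inv_scaling power2_eq_square field_simps)
qed

lemma conjugate_scaling_scaling:
  assumes "r \<noteq> 0"
  shows "conjugate (scaling r) (scaling c) = scaling c"
proof -
  have "r * c * inverse r = c" using assms by simp
  then show ?thesis unfolding conjugate_def inv_scaling[OF assms] scaling_comp by (rule arg_cong)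
qed

lemma antiinversion_1_reflection: "is_reflection (antiinversion 1)"
  unfolding is_reflection_def
proof (intro conjI exI)
  show "antiinversion 1 \<in> antimoebius" by (rule antiinversion_in_antimoebius) simp
  have "(antiinversion 1 \<circ> antiinversion 1) s = id s" for s by (cases s) simp_all
  then show "antiinversion 1 \<circ> antiinversion 1 = id" ..
  show "antiinversion 1 (Pt 1) = Pt 1" by simp
qed

text \<open>The conjugation takes place in two steps: the first makes the automorphisms rotations, which,
  for a pseudo-real map, forces the antiholomorphic ones to have the form \<open>antiinversion b\<close>;
  the second is a dilation, which leaves the rotations unchanged and normalizes \<open>\<bar>b\<bar>\<close> to \<open>1\<close>.\<close>

lemma pseudo_real_normal_form:
  assumes rat: "rational \<phi>" and pr: "pseudo_real \<phi>"
    and n: "n \<ge> 2" and cyc: "Aut_group \<phi> \<cong> integer_mod_group n"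
  obtains S \<psi> \<alpha> where "S \<in> PSL2C" "conjugate S \<phi> = rat_map (equivariant \<psi> n)"
    "cmod \<alpha> = 1" "antiinversion \<alpha> \<in> antiAut (rat_map (equivariant \<psi> n))"
proof -
  obtain g where g: "g \<in> Aut \<phi>" "\<And>k. g ^^ k = id \<longleftrightarrow> n dvd k"
    "\<And>T. T \<in> Aut \<phi> \<Longrightarrow> \<exists>k. T = g ^^ k"
    using Aut_group_cyclic[OF cyc] n by auto
  have "g \<in> PSL2C" using g(1) unfolding Aut_iff by blast
  moreover have "g \<noteq> id" using g(2)[of 1] n by simp
  moreover have "g ^^ n = id" using g(2) by simp
  ultimately obtain S c where S: "S \<in> PSL2C" and c0: "c \<noteq> 0" and Sg: "conjugate S g = scaling c"
    using finite_order_diagonalizable n by (metis less_le_trans pos2)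
  note bS = PSL2C_bij[OF S]
  let ?\<phi> = "conjugate S \<phi>"
  have pow: "conjugate S (g ^^ k) = scaling (c ^ k)" for k
    using conjugate_funpow[OF bS] Sg scaling_funpow by simp
  have prim: "c ^ k = 1 \<longleftrightarrow> n dvd k" for k
  proof -
    have "c ^ k = 1 \<longleftrightarrow> conjugate S (g ^^ k) = conjugate S id"
      using pow conjugate_id[OF bS] scaling_1 scaling_eq_iff by metis
    also have "\<dots> \<longleftrightarrow> g ^^ k = id" using conjugate_inv(1)[OF bS] by metis
    finally show ?thesis using g(2) by simp
  qed
  have c1: "c \<noteq> 1" using prim[of 1] n by auto
  have "c ^ n = 1" using prim by simp
  then have cnorm: "cmod c = 1"
    using n by (metis norm_one norm_power power_eq_1_iff norm_ge_zero not_numeral_le_zero)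
  have Aut: "\<exists>k. T = scaling (c ^ k)" if "T \<in> Aut ?\<phi>" for T
    using that bij_betw_conjugate_Aut[OF S, of \<phi>] g(3) pow by (metis bij_betw_imp_surj_on imageE)
  have cAut: "scaling c \<in> Aut ?\<phi>" using conjugate_Aut[OF S g(1)] Sg by simp
  have pr': "pseudo_real ?\<phi>" using pr pseudo_real_conjugate_iff[OF S] by simp
  then obtain Q where Q: "Q \<in> antiAut ?\<phi>" unfolding pseudo_real_def by blast
  then have Qanti: "Q \<in> antimoebius" unfolding antiAut_iff by blast
  have "T (Pt 0) = Pt 0 \<and> T Inf = Inf" if "T \<in> Aut ?\<phi>" for T
    using Aut[OF that] by auto
  then have "Q (Pt 0) = Pt 0 \<and> Q Inf = Inf \<or> Q (Pt 0) = Inf \<and> Q Inf = Pt 0"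
    using antiAut_permutes_0_Inf[OF cAut c1 _ Q] by blast
  moreover have "\<not> (Q (Pt 0) = Pt 0 \<and> Q Inf = Inf)"
  proof
    assume "Q (Pt 0) = Pt 0 \<and> Q Inf = Inf"
    then obtain b where b: "b \<noteq> 0" "Q = scaling b \<circ> sphere_cnj"
      using antimoebius_fixing_0_Inf[OF Qanti] by blast
    obtain k where k: "Q \<circ> Q = scaling (c ^ k)"
      using Aut[OF antiAut_comp_antiAut[OF Q Q]] by blast
    have "b * cnj b = c ^ k" using fun_cong[OF k, of "Pt 1"] unfolding b(2) by simp
    then have "cmod (b * cnj b) = 1" using cnorm by (simp add: norm_power)
    then have "(cmod b)\<^sup>2 = 1" by (simp add: norm_mult power2_eq_square)
    then have "cmod b = 1" by (simp add: power2_eq_1_iff) (smt (verit) norm_ge_zero)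
    then have "is_reflection Q" unfolding b(2) by (rule scaled_cnj_reflection)
    then show False using pr' Q unfolding pseudo_real_def by blast
  qed
  ultimately obtain b where b: "b \<noteq> 0" "Q = antiinversion b"
    using antimoebius_swapping_0_Inf[OF Qanti] by blast
  \<comment> \<open>Conjugation by the dilation with factor \<open>r\<close> multiplies \<open>b\<close> by \<open>r\<^sup>2\<close>.\<close>
  define r where "r = 1 / sqrt (cmod b)"
  have r: "r \<noteq> 0" "r\<^sup>2 * cmod b = 1" using b(1) by (simp_all add: r_def power_divide)
  let ?D = "scaling (complex_of_real r)"
  have D: "?D \<in> PSL2C" using r by (intro scaling_in_PSL2C) simp
  define \<alpha> where "\<alpha> = complex_of_real (r\<^sup>2) * b"
  have \<alpha>: "cmod \<alpha> = 1" using r by (simp add: \<alpha>_def norm_mult norm_power)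
  have Q': "antiinversion \<alpha> \<in> antiAut (conjugate ?D ?\<phi>)"
    using conjugate_antiAut[OF D Q] conjugate_scaling_antiinversion[OF r(1)] unfolding b(2) \<alpha>_def by simp
  have cAut': "scaling c \<in> Aut (conjugate ?D ?\<phi>)"
    using conjugate_Aut[OF D cAut] conjugate_scaling_scaling[of "complex_of_real r" c] r by simp
  have "rational (conjugate ?D ?\<phi>)" by (intro conjugate_rational rat S D)
  then show ?thesis
  proof (cases rule: rational_cases)
    case 1
    \<comment> \<open>The constant map \<open>Inf\<close> does not commute with a map that moves \<open>Inf\<close>.\<close>
    have "antiinversion \<alpha> (conjugate ?D ?\<phi> Inf) = conjugate ?D ?\<phi> (antiinversion \<alpha> Inf)"
      using Q' unfolding antiAut_iff by blast
    then show ?thesis unfolding 1 by simp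
  next
    case (2 f)
    obtain \<psi> where "f = equivariant \<psi> n"
      using equivariant_form[of n c f] prim cAut' n unfolding 2 by auto
    then have "conjugate (?D \<circ> S) \<phi> = rat_map (equivariant \<psi> n)"
      using conjugate_conjugate[OF bS PSL2C_bij[OF D], of \<phi>] 2 by simp
    moreover from this have "antiinversion \<alpha> \<in> antiAut (rat_map (equivariant \<psi> n))"
      using Q' conjugate_conjugate[OF bS PSL2C_bij[OF D], of \<phi>] by simp
    ultimately show ?thesis using that[OF PSL2C_comp[OF D S]] \<alpha> by blast
  qed
qed

theorem theorem7:
  fixes \<phi> :: "csphere \<Rightarrow> csphere" and d n :: nat
  assumes "\<phi> \<in> Rat d" and "d \<ge> 3" and "odd d"
    and "n \<ge> 2" and "Aut_group \<phi> \<cong> integer_mod_group n"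
  shows "pseudo_real \<phi> \<longleftrightarrow>
    (\<exists>\<psi> :: ratfun.
       moebius_conjugate \<phi> (rat_map (rat_var * rat_comp \<psi> (rat_var ^ n))) \<and>
       (\<forall>\<theta> :: real. \<psi> \<noteq> rat_comp (rat_cnj \<psi>) (rat_const (cis \<theta>) * rat_var)) \<and>
       (\<exists>\<alpha> :: complex. \<alpha> \<noteq> 0 \<and> cmod \<alpha> = 1 \<and> \<alpha> ^ n \<noteq> 1 \<and>
          \<psi> * rat_comp (rat_cnj \<psi>) (rat_const (\<alpha> ^ n) / rat_var) = 1))"
    (is "_ \<longleftrightarrow> (\<exists>\<psi>. ?conj \<psi> \<and> ?not_real \<psi> \<and> ?unitary \<psi>)")
proof
  have n: "n > 0" using assms(4) by simp
  assume pr: "pseudo_real \<phi>"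
  have "rational \<phi>" using assms(1) rational_rat_map unfolding Rat_def by blast
  then obtain S \<psi> \<alpha> where S: "S \<in> PSL2C" "conjugate S \<phi> = rat_map (equivariant \<psi> n)"
    and \<alpha>: "cmod \<alpha> = 1" "antiinversion \<alpha> \<in> antiAut (rat_map (equivariant \<psi> n))"
    using pseudo_real_normal_form[OF _ pr assms(4,5)] by blast
  have no_refl: "\<not> is_reflection Q" if "Q \<in> antiAut (rat_map (equivariant \<psi> n))" for Q
    using pr pseudo_real_conjugate_iff[OF S(1), of \<phi>] that unfolding S(2) pseudo_real_def by blast
  have \<alpha>0: "\<alpha> \<noteq> 0" using \<alpha>(1) by auto
  have "?conj \<psi>" using S unfolding moebius_conjugate_def conjugate_def by metis
  moreover have "?not_real \<psi>"
  proof (intro allI notI)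
    fix \<theta> :: real
    assume *: "\<psi> = rat_comp (rat_cnj \<psi>) (rat_const (cis \<theta>) * rat_var)"
    let ?\<mu> = "cis (- \<theta> / n)"
    have "cnj ?\<mu> ^ n = cis \<theta>" using n by (simp add: cis_cnj Complex.DeMoivre)
    then have "scaling ?\<mu> \<circ> sphere_cnj \<in> antiAut (rat_map (equivariant \<psi> n))"
      using scaled_cnj_in_antiAut[OF n, of ?\<mu> \<psi>] * by simp
    then show False using no_refl scaled_cnj_reflection[of ?\<mu>] by simp
  qed
  moreover have "\<alpha> ^ n \<noteq> 1"
  proof
    assume "\<alpha> ^ n = 1"
    then have "scaling (inverse \<alpha>) \<in> Aut (rat_map (equivariant \<psi> n))"
      by (intro rotation_in_Aut n) (simp add: power_inverse)
    from Aut_comp_antiAut[OF this \<alpha>(2)]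
    have "scaling (inverse \<alpha>) \<circ> antiinversion \<alpha> \<in> antiAut (rat_map (equivariant \<psi> n))" .
    moreover have "scaling (inverse \<alpha>) \<circ> antiinversion \<alpha> = antiinversion 1"
    proof
      fix s show "(scaling (inverse \<alpha>) \<circ> antiinversion \<alpha>) s = antiinversion 1 s"
        using \<alpha>0 by (cases s) (simp_all add: field_simps)
    qed
    ultimately show False using no_refl antiinversion_1_reflection by simp
  qed
  ultimately show "\<exists>\<psi>. ?conj \<psi> \<and> ?not_real \<psi> \<and> ?unitary \<psi>"
    using \<alpha> \<alpha>0 antiinversion_in_antiAut_iff[OF n \<alpha>0] by blast
next
  have n: "n > 0" using assms(4) by simp
  assume "\<exists>\<psi>. ?conj \<psi> \<and> ?not_real \<psi> \<and> ?unitary \<psi>"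
  then obtain \<psi> \<alpha> S where S: "S \<in> PSL2C" "conjugate S \<phi> = rat_map (equivariant \<psi> n)"
    and \<alpha>: "\<alpha> \<noteq> 0" "cmod \<alpha> = 1" "\<alpha> ^ n \<noteq> 1"
    and eq: "\<psi> * rat_comp (rat_cnj \<psi>) (rat_const (\<alpha> ^ n) / rat_var) = 1"
    unfolding moebius_conjugate_def conjugate_def by metis
  obtain f where "f \<in> iso (Aut_group \<phi>) (integer_mod_group n)"
    using assms(5) unfolding is_iso_def by blast
  then have "bij_betw f (Aut \<phi>) {0..<int n}"
    using n by (simp add: iso_def Aut_group_def carrier_integer_mod_group)
  then have "card (Aut \<phi>) = n" by (simp add: bij_betw_same_card)
  then have "card (Aut (rat_map (equivariant \<psi> n))) = n"
    using bij_betw_same_card[OF bij_betw_conjugate_Aut[OF S(1), of \<phi>]] unfolding S(2) by simp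
  then have "pseudo_real (conjugate S \<phi>)"
    using pseudo_real_equivariant[OF n _ \<alpha>(2,3)] antiinversion_in_antiAut_iff[OF n \<alpha>(1)] eq
    unfolding S(2) by blast
  then show "pseudo_real \<phi>" using pseudo_real_conjugate_iff[OF S(1)] by simp
qed

end
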